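(* Let $d\ge 1$ and $m\ge d+1$. Let $G=(V,E)$ be a graph, and let $V_1,\ldots,V_m$ be a partition of $V$ into nonempty sets. Assume that the reduced graph $G'$ associated with this partition is $d$-rigid, and that for every $1\le i\le m$ and every pair of distinct vertices $u,v\in V_i$, there are at least $d$ distinct indices $j\in[m]\setminus\{i\}$ such that $u$ and $v$ lie in the same connected component of $G[V_i,V_j]$. Then $G$ is $d$-rigid.
   Context: For disjoint $A,B\subseteq V$, $G[A,B]$ is the bipartite graph on $A\cup B$ whose edges are the edges of $G$ with one endpoint in $A$ and the other in $B$. The reduced graph is $G'=([m],E')$ with $\{i,j\}\in E'$ iff $G$ has an edge between $V_i$ and $V_j$. A $d$-dimensional framework $(G,\mathbf{p})$ is rigid if every continuous edge-length-preserving motion of the vertices starting at $\mathbf{p}$ preserves all pairwise distances; $\mathbf{p}$ is generic if its coordinates are algebraically independent over $\mathbb{Q}$; a graph is $d$-rigid if $(G,\mathbf{p})$ is rigid for some (equivalently, every) generic $\mathbf{p}:V\to\mathbb{R}^d$. *)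

theory Defs
  imports
    "HOL-Analysis.Analysis"
    "HOL-Library.Poly_Mapping"
    "HOL-Library.Disjoint_Sets"
begin

text \<open>A graph is given by its vertex set and its set of edges, an edge being the two-element
  set of its endpoints. Graphs are finite and simple.\<close>

definition simple_graph :: "'v set \<Rightarrow> 'v set set \<Rightarrow> bool" where
  "simple_graph V E \<longleftrightarrow> finite V \<and> (\<forall>e\<in>E. e \<subseteq> V \<and> card e = 2)"

definition same_component :: "'v set \<Rightarrow> 'v set set \<Rightarrow> 'v \<Rightarrow> 'v \<Rightarrow> bool" where
  "same_component V E u v \<longleftrightarrow> u \<in> V \<and> v \<in> V \<and> (u, v) \<in> {(x, y). {x, y} \<in> E}\<^sup>*"

text \<open>The edge set of \<open>G[A,B]\<close>; its vertex set is \<open>A \<union> B\<close>.\<close>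

definition bip_edges :: "'v set set \<Rightarrow> 'v set \<Rightarrow> 'v set \<Rightarrow> 'v set set" where
  "bip_edges E A B = {{u, v} | u v. u \<in> A \<and> v \<in> B \<and> {u, v} \<in> E}"

text \<open>The edge set of the reduced graph, whose vertex set is \<open>{1..m}\<close>.\<close>

definition reduced_edges :: "'v set set \<Rightarrow> (nat \<Rightarrow> 'v set) \<Rightarrow> nat \<Rightarrow> nat set set" where
  "reduced_edges E P m =
     {{i, j} | i j. i \<in> {1..m} \<and> j \<in> {1..m} \<and> i \<noteq> j \<and> (\<exists>u\<in>P i. \<exists>v\<in>P j. {u, v} \<in> E)}"

text \<open>A polynomial with rational coefficients in variables of type \<open>'i\<close> is a finitely supported
  map from monomials to coefficients, a monomial being a finitely supported map from variables
  to exponents.\<close>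

definition eval_poly :: "('i \<Rightarrow> real) \<Rightarrow> (('i \<Rightarrow>\<^sub>0 nat) \<Rightarrow>\<^sub>0 rat) \<Rightarrow> real" where
  "eval_poly x f =
     (\<Sum>a\<in>Poly_Mapping.keys f. of_rat (Poly_Mapping.lookup f a) *
        (\<Prod>i\<in>Poly_Mapping.keys a. x i ^ Poly_Mapping.lookup a i))"

definition alg_independent_rat :: "'i set \<Rightarrow> ('i \<Rightarrow> real) \<Rightarrow> bool" where
  "alg_independent_rat I x \<longleftrightarrow>
     (\<forall>f. (\<forall>a\<in>Poly_Mapping.keys f. Poly_Mapping.keys a \<subseteq> I) \<and> eval_poly x f = 0 \<longrightarrow> f = 0)"

text \<open>A framework in dimension \<open>d = CARD('d)\<close> is a graph with a placement
  \<open>p :: 'v \<Rightarrow> real ^ 'd\<close>, of which only the values on the vertex set matter.\<close>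

definition generic_placement :: "'v set \<Rightarrow> ('v \<Rightarrow> real ^ 'd::finite) \<Rightarrow> bool" where
  "generic_placement V p \<longleftrightarrow> alg_independent_rat (V \<times> (UNIV :: 'd set)) (\<lambda>(v, i). p v $ i)"

definition rigid_framework :: "'v set \<Rightarrow> 'v set set \<Rightarrow> ('v \<Rightarrow> real ^ 'd::finite) \<Rightarrow> bool" where
  "rigid_framework V E p \<longleftrightarrow>
     (\<forall>q :: 'v \<Rightarrow> real \<Rightarrow> real ^ 'd.
        (\<forall>v\<in>V. continuous_on {0..1} (q v) \<and> q v 0 = p v) \<and>
        (\<forall>t\<in>{0..1}. \<forall>u\<in>V. \<forall>v\<in>V. {u, v} \<in> E \<longrightarrow> dist (q u t) (q v t) = dist (p u) (p v))
        \<longrightarrow> (\<forall>t\<in>{0..1}. \<forall>u\<in>V. \<forall>v\<in>V. dist (q u t) (q v t) = dist (p u) (p v)))"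

text \<open>Rigidity for some generic placement is equivalent to rigidity for every generic placement;
  the type argument carries the dimension \<open>CARD('d)\<close>.\<close>

definition d_rigid :: "'d::finite itself \<Rightarrow> 'v set \<Rightarrow> 'v set set \<Rightarrow> bool" where
  "d_rigid _ V E \<longleftrightarrow>
     (\<exists>p :: 'v \<Rightarrow> real ^ 'd. generic_placement V p \<and> rigid_framework V E p)"

end

theory Submission
  imports Defs "HOL-Computational_Algebra.Polynomial"
begin

text \<open>The idea is to place all vertices of \<open>P i\<close> at the same point \<open>p i\<close>, where \<open>p\<close> is a generic rigid
  placement of the reduced graph. An infinitesimal motion \<open>w\<close> of this coincident framework has
  \<open>w \<bullet> (p j - p i)\<close> constant on every component of \<open>G[P i, P j]\<close>, so for two vertices of \<open>P i\<close> the
  difference of velocities is orthogonal to \<open>d\<close> linearly independent vectors and vanishes. Thus \<open>w\<close>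
  is a motion of the reduced framework and trivial there. Infinitesimal rigidity is an open
  condition, hence holds near some generic placement of \<open>V\<close>, and it implies rigidity.

  Infinitesimal rigidity and rigidity are compared through the identity
  \<open>|q\<^sub>u - q\<^sub>v|\<^sup>2 - |p\<^sub>u - p\<^sub>v|\<^sup>2 = 2 (m\<^sub>u - m\<^sub>v) \<bullet> (w\<^sub>u - w\<^sub>v)\<close> with \<open>m = (p + q) / 2\<close> and \<open>w = q - p\<close>:
  equivalent placements \<open>p\<close>, \<open>q\<close> differ by an infinitesimal motion of their midpoint. This
  replaces differentiation along paths.\<close>

section \<open>Rational polynomials and generic placements\<close>

definition eval_monom :: "('i \<Rightarrow> real) \<Rightarrow> ('i \<Rightarrow>\<^sub>0 nat) \<Rightarrow> real" where
  "eval_monom x a = (\<Prod>i\<in>Poly_Mapping.keys a. x i ^ Poly_Mapping.lookup a i)"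

lemma eval_monom_superset:
  assumes "finite I" "Poly_Mapping.keys a \<subseteq> I"
  shows "eval_monom x a = (\<Prod>i\<in>I. x i ^ Poly_Mapping.lookup a i)"
  unfolding eval_monom_def
  by (rule prod.mono_neutral_left) (use assms in \<open>auto simp: in_keys_iff\<close>)

lemma eval_monom_add: "eval_monom x (a + b) = eval_monom x a * eval_monom x b"
proof -
  let ?I = "Poly_Mapping.keys a \<union> Poly_Mapping.keys b"
  have "eval_monom x (a + b) = (\<Prod>i\<in>?I. x i ^ Poly_Mapping.lookup (a + b) i)"
    by (rule eval_monom_superset) (simp_all add: keys_add)
  also have "\<dots> = (\<Prod>i\<in>?I. x i ^ Poly_Mapping.lookup a i) * (\<Prod>i\<in>?I. x i ^ Poly_Mapping.lookup b i)"
    by (simp add: lookup_add power_add prod.distrib)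
  also have "\<dots> = eval_monom x a * eval_monom x b"
    by (simp add: eval_monom_superset[of ?I])
  finally show ?thesis .
qed

lemma eval_poly_superset:
  assumes "finite A" "Poly_Mapping.keys f \<subseteq> A"
  shows "eval_poly x f = (\<Sum>a\<in>A. of_rat (Poly_Mapping.lookup f a) * eval_monom x a)"
  unfolding eval_poly_def eval_monom_def
  by (rule sum.mono_neutral_left) (use assms in \<open>auto simp: in_keys_iff\<close>)

lemma eval_poly_zero [simp]: "eval_poly x 0 = 0"
  by (simp add: eval_poly_def)

lemma eval_poly_single: "eval_poly x (Poly_Mapping.single a c) = of_rat c * eval_monom x a"
  by (subst eval_poly_superset[of "{a}"]) auto

lemma eval_poly_add: "eval_poly x (f + g) = eval_poly x f + eval_poly x g"
proof -
  let ?A = "Poly_Mapping.keys f \<union> Poly_Mapping.keys g"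
  have "eval_poly x (f + g) = (\<Sum>a\<in>?A. of_rat (Poly_Mapping.lookup (f + g) a) * eval_monom x a)"
    by (rule eval_poly_superset) (simp_all add: keys_add)
  also have "\<dots> = eval_poly x f + eval_poly x g"
    by (simp add: eval_poly_superset[of ?A] lookup_add of_rat_add algebra_simps sum.distrib)
  finally show ?thesis .
qed

lemma eval_poly_diff: "eval_poly x (f - g) = eval_poly x f - eval_poly x g"
  using eval_poly_add[of x "f - g" g] by simp

lemma eval_poly_sum: "eval_poly x (sum f A) = (\<Sum>a\<in>A. eval_poly x (f a))"
  by (induction A rule: infinite_finite_induct) (auto simp: eval_poly_add)

lemma poly_mapping_sum_single:
  "(\<Sum>a\<in>Poly_Mapping.keys f. Poly_Mapping.single a (Poly_Mapping.lookup f a)) = f"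
  by (rule poly_mapping_eqI)
    (auto simp: lookup_sum lookup_single when_def in_keys_iff)

lemma eval_poly_mult: "eval_poly x (f * g) = eval_poly x f * eval_poly x g"
proof -
  have "f * g = (\<Sum>a\<in>Poly_Mapping.keys f. \<Sum>b\<in>Poly_Mapping.keys g.
      Poly_Mapping.single (a + b) (Poly_Mapping.lookup f a * Poly_Mapping.lookup g b))"
    by (subst (1) poly_mapping_sum_single[of f, symmetric],
        subst (1) poly_mapping_sum_single[of g, symmetric])
      (simp add: sum_product mult_single)
  then have "eval_poly x (f * g) = (\<Sum>a\<in>Poly_Mapping.keys f. \<Sum>b\<in>Poly_Mapping.keys g.
      (of_rat (Poly_Mapping.lookup f a) * eval_monom x a) * (of_rat (Poly_Mapping.lookup g b) * eval_monom x b))"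
    by (simp add: eval_poly_sum eval_poly_single eval_monom_add of_rat_mult mult_ac)
  also have "\<dots> = eval_poly x f * eval_poly x g"
    by (simp add: sum_product[symmetric] eval_poly_superset[OF finite_keys order_refl])
  finally show ?thesis .
qed

text \<open>Such a map is determined by its graph over its support, a finite subset of the countable
  set \<open>A \<times> UNIV\<close>.\<close>

lemma countable_poly_mapping_keys_subset:
  assumes "countable A"
  shows "countable {f :: 'a \<Rightarrow>\<^sub>0 'b::{zero,countable}. Poly_Mapping.keys f \<subseteq> A}"
proof -
  define graph :: "('a \<Rightarrow>\<^sub>0 'b) \<Rightarrow> ('a \<times> 'b) set"
    where "graph f = (\<lambda>a. (a, Poly_Mapping.lookup f a)) ` Poly_Mapping.keys f" for f
  have mem: "(a, b) \<in> graph f \<longleftrightarrow> b = Poly_Mapping.lookup f a \<and> b \<noteq> 0" for a b f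
    by (auto simp: graph_def in_keys_iff)
  have inj: "inj graph"
  proof (rule injI)
    fix f g :: "'a \<Rightarrow>\<^sub>0 'b" assume "graph f = graph g"
    then have "\<And>a b. b = Poly_Mapping.lookup f a \<and> b \<noteq> 0 \<longleftrightarrow> b = Poly_Mapping.lookup g a \<and> b \<noteq> 0"
      by (metis mem)
    then show "f = g" by (metis poly_mapping_eqI)
  qed
  have "countable {X. X \<subseteq> A \<times> (UNIV :: 'b set) \<and> finite X}"
    using countable_Collect_finite_subset[of "A \<times> (UNIV :: 'b set)"] assms by (simp add: conj_commute)
  moreover have "graph ` {f. Poly_Mapping.keys f \<subseteq> A} \<subseteq> {X. X \<subseteq> A \<times> (UNIV :: 'b set) \<and> finite X}"
    by (auto simp: graph_def)
  ultimately have "countable (graph ` {f. Poly_Mapping.keys f \<subseteq> A})"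
    by (meson countable_subset)
  then show ?thesis
    by (rule countable_image_inj_on) (use inj in \<open>auto intro: inj_on_subset\<close>)
qed

definition poly_in :: "'i set \<Rightarrow> (('i \<Rightarrow>\<^sub>0 nat) \<Rightarrow>\<^sub>0 rat) \<Rightarrow> bool" where
  "poly_in I f \<longleftrightarrow> (\<forall>a\<in>Poly_Mapping.keys f. Poly_Mapping.keys a \<subseteq> I)"

lemma alg_independent_rat_poly_in:
  "alg_independent_rat I x \<longleftrightarrow> (\<forall>f. poly_in I f \<longrightarrow> eval_poly x f = 0 \<longrightarrow> f = 0)"
  by (auto simp: alg_independent_rat_def poly_in_def)

lemma poly_in_mult: "poly_in I f \<Longrightarrow> poly_in I g \<Longrightarrow> poly_in I (f * g)"
  unfolding poly_in_def by (fastforce dest!: subsetD[OF keys_mult] subsetD[OF keys_add])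

lemma poly_in_diff: "poly_in I f \<Longrightarrow> poly_in I g \<Longrightarrow> poly_in I (f - g)"
  unfolding poly_in_def by (metis (no_types, lifting) keys_diff Un_iff subsetD)

lemma countable_poly_in:
  assumes "finite I"
  shows "countable {f. poly_in I f}"
proof -
  have "countable {a :: 'a \<Rightarrow>\<^sub>0 nat. Poly_Mapping.keys a \<subseteq> I}"
    using assms by (simp add: countable_poly_mapping_keys_subset countable_finite)
  then have "countable {f :: ('a \<Rightarrow>\<^sub>0 nat) \<Rightarrow>\<^sub>0 rat. Poly_Mapping.keys f \<subseteq> {a. Poly_Mapping.keys a \<subseteq> I}}"
    by (rule countable_poly_mapping_keys_subset)
  then show ?thesis
    by (rule countable_subset[rotated]) (auto simp: poly_in_def)
qed

text \<open>Read as a polynomial in the single variable \<open>i\<close>, with the other variables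
  evaluated at \<open>x\<close>, \<open>f\<close> becomes the real polynomial \<open>Q\<close>
  below. One coefficient of \<open>Q\<close> is the value at \<open>x\<close> of a nonzero rational
  polynomial in the variables \<open>I\<close>, so independence of \<open>x\<close> makes
  \<open>Q\<close> nonzero.\<close>

lemma finite_roots_eval_poly_upd:
  assumes "i \<notin> I" and ind: "alg_independent_rat I x" and f: "poly_in (insert i I) f" "f \<noteq> 0"
  shows "finite {t. eval_poly (x(i := t)) f = 0}"
proof -
  \<comment> \<open>\<open>res a\<close> deletes the variable \<open>i\<close> from the monomial
    \<open>a\<close>.\<close>
  define res :: "('a \<Rightarrow>\<^sub>0 nat) \<Rightarrow> ('a \<Rightarrow>\<^sub>0 nat)"
    where "res a = a - Poly_Mapping.single i (Poly_Mapping.lookup a i)" for a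
  have lookup_res: "Poly_Mapping.lookup (res a) j = (if j = i then 0 else Poly_Mapping.lookup a j)" for a j
    by (auto simp: res_def lookup_minus lookup_single when_def)
  have keys_res: "Poly_Mapping.keys (res a) = Poly_Mapping.keys a - {i}" for a
    by (auto simp: in_keys_iff lookup_res split: if_splits)
  have res_inj: "a = b" if "res a = res b" "Poly_Mapping.lookup a i = Poly_Mapping.lookup b i" for a b
    using that by (metis poly_mapping_eqI lookup_res)
  have mon: "eval_monom (x(i := t)) a = t ^ Poly_Mapping.lookup a i * eval_monom x (res a)" for t a
  proof -
    have "eval_monom (x(i := t)) a
      = (\<Prod>j\<in>insert i (Poly_Mapping.keys a - {i}). (x(i := t)) j ^ Poly_Mapping.lookup a j)"
      by (rule eval_monom_superset) auto
    also have "\<dots> = t ^ Poly_Mapping.lookup a i * (\<Prod>j\<in>Poly_Mapping.keys a - {i}. x j ^ Poly_Mapping.lookup a j)"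
      by (subst prod.insert) auto
    also have "(\<Prod>j\<in>Poly_Mapping.keys a - {i}. x j ^ Poly_Mapping.lookup a j) = eval_monom x (res a)"
      by (simp add: eval_monom_def keys_res lookup_res)
    finally show ?thesis .
  qed
  define Q where "Q = (\<Sum>a\<in>Poly_Mapping.keys f.
    monom (of_rat (Poly_Mapping.lookup f a) * eval_monom x (res a)) (Poly_Mapping.lookup a i))"
  have eval: "eval_poly (x(i := t)) f = poly Q t" for t
    by (simp add: Q_def poly_sum poly_monom eval_poly_superset[OF finite_keys order_refl] mon mult_ac)
  obtain b where b: "b \<in> Poly_Mapping.keys f"
    using f(2) by (metis poly_mapping_eqI in_keys_iff lookup_zero)
  define k where "k = Poly_Mapping.lookup b i"
  define A where "A = {a \<in> Poly_Mapping.keys f. Poly_Mapping.lookup a i = k}"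
  \<comment> \<open>\<open>g\<close> is the coefficient of the \<open>k\<close>-th power of the
    variable \<open>i\<close> in \<open>f\<close>. The monomials in \<open>A\<close> share the
    exponent \<open>k\<close>, so \<open>res\<close> keeps them distinct and nothing cancels in
    \<open>g\<close>.\<close>
  define g where "g = (\<Sum>a\<in>A. Poly_Mapping.single (res a) (Poly_Mapping.lookup f a))"
  have [simp]: "finite A" by (simp add: A_def)
  have "Poly_Mapping.lookup g (res b) = (\<Sum>a\<in>A. if a = b then Poly_Mapping.lookup f a else 0)"
    unfolding g_def lookup_sum
    by (rule sum.cong) (auto simp: lookup_single when_def A_def k_def dest: res_inj)
  also have "\<dots> = Poly_Mapping.lookup f b"
    using b by (simp add: A_def k_def)
  finally have "g \<noteq> 0" using b by (metis in_keys_iff lookup_zero)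
  moreover have "poly_in I g"
    unfolding poly_in_def
  proof
    fix a assume "a \<in> Poly_Mapping.keys g"
    then obtain a' where "a' \<in> A" "a \<in> Poly_Mapping.keys (Poly_Mapping.single (res a') (Poly_Mapping.lookup f a'))"
      unfolding g_def using keys_sum by fast
    then have "a = res a'" "a' \<in> Poly_Mapping.keys f" by (auto simp: A_def split: if_splits)
    then show "Poly_Mapping.keys a \<subseteq> I"
      using f(1) by (auto simp: keys_res poly_in_def)
  qed
  ultimately have "eval_poly x g \<noteq> 0"
    using ind by (auto simp: alg_independent_rat_poly_in)
  moreover have "eval_poly x g = poly.coeff Q k"
  proof -
    have "poly.coeff Q k = (\<Sum>a\<in>Poly_Mapping.keys f.
        if Poly_Mapping.lookup a i = k then of_rat (Poly_Mapping.lookup f a) * eval_monom x (res a) else 0)"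
      by (simp add: Q_def coeff_sum)
    also have "\<dots> = (\<Sum>a\<in>A. of_rat (Poly_Mapping.lookup f a) * eval_monom x (res a))"
      unfolding A_def by (simp add: sum.inter_filter)
    finally show ?thesis by (simp add: g_def eval_poly_sum eval_poly_single)
  qed
  ultimately have "Q \<noteq> 0" by auto
  then show ?thesis by (simp add: eval poly_roots_finite)
qed

text \<open>The coordinates are chosen one at a time. Given an independent choice on
  \<open>I\<close>, each of the countably many nonzero polynomials forbids only finitely many values
  of the next coordinate, and an interval is uncountable.\<close>

lemma alg_independent_rat_dense:
  assumes "finite I" "\<epsilon> > 0"
  obtains x where "alg_independent_rat I x" "\<And>i. i \<in> I \<Longrightarrow> \<bar>x i - x0 i\<bar> < \<epsilon>"
proof -
  have "\<exists>x. alg_independent_rat I x \<and> (\<forall>i\<in>I. \<bar>x i - x0 i\<bar> < \<epsilon>)"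
    using assms(1)
  proof induction
    case empty
    have "f = 0" if "poly_in {} f" "eval_poly x0 f = 0" for f :: "('a \<Rightarrow>\<^sub>0 nat) \<Rightarrow>\<^sub>0 rat"
    proof -
      have sub: "Poly_Mapping.keys f \<subseteq> {0}"
      proof
        fix a assume "a \<in> Poly_Mapping.keys f"
        then have "Poly_Mapping.keys a = {}" using that(1) by (auto simp: poly_in_def)
        then have "a = 0" by (metis poly_mapping_eqI lookup_zero in_keys_iff empty_iff)
        then show "a \<in> {0}" by simp
      qed
      then have "Poly_Mapping.lookup f 0 = 0"
        using that(2) by (subst (asm) eval_poly_superset[of "{0}"]) (auto simp: eval_monom_def)
      with sub show ?thesis
        by (metis poly_mapping_eqI in_keys_iff lookup_zero singletonD subsetD)
    qed
    then show ?case by (auto simp: alg_independent_rat_poly_in)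
  next
    case (insert i I)
    then obtain x where x: "alg_independent_rat I x" "\<forall>i\<in>I. \<bar>x i - x0 i\<bar> < \<epsilon>" by blast
    define B where "B = (\<Union>f\<in>{f. poly_in (insert i I) f} - {0}. {t. eval_poly (x(i := t)) f = 0})"
    have "countable B"
      unfolding B_def using insert.hyps x(1)
      by (intro countable_UN countable_Diff countable_poly_in countable_finite finite_roots_eval_poly_upd) auto
    moreover have "uncountable {x0 i - \<epsilon> <..< x0 i + \<epsilon>}"
      using assms(2) by (simp add: uncountable_open_interval)
    ultimately have "uncountable ({x0 i - \<epsilon> <..< x0 i + \<epsilon>} - B)"
      by (rule uncountable_minus_countable[rotated])
    then obtain t where t: "t \<in> {x0 i - \<epsilon> <..< x0 i + \<epsilon>} - B"
      by (metis countable_empty equals0I)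
    then have "alg_independent_rat (insert i I) (x(i := t))"
      by (auto simp: alg_independent_rat_poly_in B_def)
    moreover have "\<forall>j\<in>insert i I. \<bar>(x(i := t)) j - x0 j\<bar> < \<epsilon>"
      using t x(2) insert.hyps by auto
    ultimately show ?case by blast
  qed
  then show ?thesis using that by blast
qed

section \<open>Polynomial functions of a placement and density of generic placements\<close>

text \<open>Polynomials appear here as functions of the placement, so that elimination can combine
  matrix entries pointwise without handling coefficients.\<close>

definition rational_polynomial_fun :: "'v set \<Rightarrow> (('v \<Rightarrow> real ^ 'd::finite) \<Rightarrow> real) \<Rightarrow> bool" where
  "rational_polynomial_fun V g \<longleftrightarrow>
     (\<exists>f. poly_in (V \<times> UNIV) f \<and> (\<forall>p. g p = eval_poly (\<lambda>(v, i). p v $ i) f))"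

lemma rational_polynomial_fun_coord:
  assumes "v \<in> V"
  shows "rational_polynomial_fun V (\<lambda>p. p v $ i)"
  unfolding rational_polynomial_fun_def
proof (intro exI conjI allI)
  let ?f = "Poly_Mapping.single (Poly_Mapping.single (v, i) (1::nat)) (1::rat)"
  show "poly_in (V \<times> UNIV) ?f" using assms by (auto simp: poly_in_def)
  show "p v $ i = eval_poly (\<lambda>(v, i). p v $ i) ?f" for p :: "'a \<Rightarrow> real ^ 'b"
    by (simp add: eval_poly_single eval_monom_def)
qed

lemma rational_polynomial_fun_zero: "rational_polynomial_fun V (\<lambda>p. 0)"
  unfolding rational_polynomial_fun_def by (rule exI[of _ 0]) (auto simp: poly_in_def)

lemma rational_polynomial_fun_diff:
  "rational_polynomial_fun V f \<Longrightarrow> rational_polynomial_fun V g \<Longrightarrow> rational_polynomial_fun V (\<lambda>p. f p - g p)"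
  unfolding rational_polynomial_fun_def by (metis (no_types) eval_poly_diff poly_in_diff)

lemma rational_polynomial_fun_mult:
  "rational_polynomial_fun V f \<Longrightarrow> rational_polynomial_fun V g \<Longrightarrow> rational_polynomial_fun V (\<lambda>p. f p * g p)"
  unfolding rational_polynomial_fun_def by (metis (no_types) eval_poly_mult poly_in_mult)

text \<open>A nonzero value anywhere shows that the representing polynomial is not the zero
  polynomial, and a generic placement is a root of no other.\<close>

lemma generic_placement_nonzero:
  assumes "generic_placement V p" "rational_polynomial_fun V f" "f q \<noteq> 0"
  shows "f p \<noteq> 0"
  using assms unfolding generic_placement_def rational_polynomial_fun_def alg_independent_rat_poly_in
  by (metis eval_poly_zero)

lemma generic_placement_dense:
  fixes p0 :: "'v \<Rightarrow> real ^ 'd::finite"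
  assumes "finite V" "\<epsilon> > 0"
  obtains p where "generic_placement V p" "\<And>v. v \<in> V \<Longrightarrow> dist (p v) (p0 v) < \<epsilon>"
proof -
  \<comment> \<open>The Euclidean norm is at most the sum of the \<open>CARD('d)\<close> absolute
    coordinates, each of which gets an equal share of \<open>\<epsilon>\<close>.\<close>
  define \<delta> where "\<delta> = \<epsilon> / real CARD('d)"
  have "\<delta> > 0" using assms(2) by (simp add: \<delta>_def)
  then obtain x where x: "alg_independent_rat (V \<times> (UNIV :: 'd set)) x"
      "\<And>i. i \<in> V \<times> UNIV \<Longrightarrow> \<bar>x i - (\<lambda>(v, i). p0 v $ i) i\<bar> < \<delta>"
    using alg_independent_rat_dense[of "V \<times> UNIV" \<delta>] assms(1) by (metis finite_SigmaI finite)
  define p :: "'v \<Rightarrow> real ^ 'd" where "p v = (\<chi> i. x (v, i))" for v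
  have "(\<lambda>(v, i). p v $ i) = x" by (auto simp: p_def)
  with x(1) have "generic_placement V p" by (simp add: generic_placement_def)
  moreover have "dist (p v) (p0 v) < \<epsilon>" if "v \<in> V" for v
  proof -
    have "dist (p v) (p0 v) \<le> (\<Sum>i\<in>UNIV. \<bar>(p v - p0 v) $ i\<bar>)"
      unfolding dist_norm by (rule norm_le_l1_cart)
    also have "\<dots> < (\<Sum>i\<in>(UNIV :: 'd set). \<delta>)"
      by (rule sum_strict_mono) (use x(2)[of "(v, _)"] that in \<open>auto simp: p_def\<close>)
    also have "\<dots> = \<epsilon>" by (simp add: \<delta>_def)
    finally show ?thesis .
  qed
  ultimately show ?thesis using that by blast
qed

section \<open>Linear independence of rows depending on a parameter\<close>

definition row_indep :: "'i set \<Rightarrow> 'j set \<Rightarrow> ('i \<Rightarrow> 'j \<Rightarrow> real) \<Rightarrow> bool" where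
  "row_indep I J M \<longleftrightarrow> (\<forall>c. (\<forall>j\<in>J. (\<Sum>i\<in>I. c i * M i j) = 0) \<longrightarrow> (\<forall>i\<in>I. c i = 0))"

lemma row_indepD:
  "row_indep I J M \<Longrightarrow> (\<And>j. j \<in> J \<Longrightarrow> (\<Sum>i\<in>I. c i * M i j) = 0) \<Longrightarrow> i \<in> I \<Longrightarrow> c i = 0"
  unfolding row_indep_def by blast

text \<open>One step of elimination with row \<open>i\<close> and pivot \<open>M i j\<close>.
  Cross-multiplying instead of dividing keeps the new entries polynomial in the old ones.\<close>

lemma row_indep_pivot:
  assumes "finite I" "i \<notin> I" "j \<in> J" "M i j \<noteq> 0"
  shows "row_indep (insert i I) J M \<longleftrightarrow> row_indep I J (\<lambda>k l. M i j * M k l - M k j * M i l)"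
proof
  assume ind: "row_indep (insert i I) J M"
  show "row_indep I J (\<lambda>k l. M i j * M k l - M k j * M i l)"
    unfolding row_indep_def
  proof (intro allI impI ballI)
    fix d k assume d: "\<forall>l\<in>J. (\<Sum>k\<in>I. d k * (M i j * M k l - M k j * M i l)) = 0" and "k \<in> I"
    \<comment> \<open>The coefficient of row \<open>i\<close> collects the multiples of that row
      which the eliminated rows subtract, so both combinations of rows agree.\<close>
    define c where "c k = (if k = i then - (\<Sum>k\<in>I. d k * M k j) else M i j * d k)" for k
    have "(\<Sum>k\<in>insert i I. c k * M k l) = 0" if "l \<in> J" for l
    proof -
      have "(\<Sum>k\<in>I. c k * M k l) = (\<Sum>k\<in>I. M i j * d k * M k l)"
        using assms(2) by (intro sum.cong) (auto simp: c_def)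
      then have "(\<Sum>k\<in>insert i I. c k * M k l) = (\<Sum>k\<in>I. M i j * d k * M k l) - (\<Sum>k\<in>I. d k * M k j) * M i l"
        using assms(1,2) by (simp add: c_def)
      also have "\<dots> = (\<Sum>k\<in>I. d k * (M i j * M k l - M k j * M i l))"
        by (simp add: sum_distrib_left sum_subtractf algebra_simps)
      finally show ?thesis using d that by simp
    qed
    then have "c k = 0" using ind \<open>k \<in> I\<close> row_indepD by (metis insertI2)
    then show "d k = 0" using assms \<open>k \<in> I\<close> by (auto simp: c_def split: if_splits)
  qed
next
  assume ind: "row_indep I J (\<lambda>k l. M i j * M k l - M k j * M i l)"
  show "row_indep (insert i I) J M"
    unfolding row_indep_def
  proof (intro allI impI)
    fix c assume c: "\<forall>l\<in>J. (\<Sum>k\<in>insert i I. c k * M k l) = 0"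
    then have c': "(\<Sum>k\<in>I. c k * M k l) = - c i * M i l" if "l \<in> J" for l
      using assms(1,2) that by (simp add: add_eq_0_iff)
    have "(\<Sum>k\<in>I. c k * (M i j * M k l - M k j * M i l)) = 0" if "l \<in> J" for l
    proof -
      have "(\<Sum>k\<in>I. c k * (M i j * M k l - M k j * M i l))
        = M i j * (\<Sum>k\<in>I. c k * M k l) - (\<Sum>k\<in>I. c k * M k j) * M i l"
        by (simp add: sum_distrib_right sum_distrib_left right_diff_distrib sum_subtractf mult_ac)
      then show ?thesis by (simp add: c' that assms(3))
    qed
    then have 0: "c k = 0" if "k \<in> I" for k using row_indepD[OF ind] that by blast
    then have "c i * M i j = 0" using c'[OF assms(3)] by simp
    then show "\<forall>k\<in>insert i I. c k = 0" using 0 assms(4) by simp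
  qed
qed

text \<open>Gaussian elimination without division: with \<open>F\<close> a neighbourhood filter and \<open>R\<close> the functions
  continuous at \<open>y\<close> this yields openness of independence, and with \<open>F\<close> principal at a generic point
  and \<open>R\<close> the rational polynomials it yields independence at generic points.\<close>

lemma row_indep_transfer:
  fixes M :: "'x \<Rightarrow> 'i \<Rightarrow> 'j \<Rightarrow> real"
  assumes closed: "\<And>f g h k. f \<in> R \<Longrightarrow> g \<in> R \<Longrightarrow> h \<in> R \<Longrightarrow> k \<in> R \<Longrightarrow> (\<lambda>x. f x * g x - h x * k x) \<in> R"
    and nonzero: "\<And>f. f \<in> R \<Longrightarrow> f y \<noteq> 0 \<Longrightarrow> eventually (\<lambda>x. f x \<noteq> 0) F"
    and "finite I"
    and "\<And>i j. i \<in> I \<Longrightarrow> j \<in> J \<Longrightarrow> (\<lambda>x. M x i j) \<in> R"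
    and "row_indep I J (M y)"
  shows "eventually (\<lambda>x. row_indep I J (M x)) F"
  using assms(3-)
proof (induction I arbitrary: M)
  case empty
  then show ?case by (simp add: row_indep_def)
next
  case (insert i I)
  have "\<exists>j\<in>J. M y i j \<noteq> 0"
  proof (rule ccontr)
    assume "\<not> (\<exists>j\<in>J. M y i j \<noteq> 0)"
    then have "(\<Sum>k\<in>insert i I. (if k = i then 1 else 0) * M y k j) = 0" if "j \<in> J" for j
      using that by (intro sum.neutral) auto
    then have "(if i = i then 1 else 0 :: real) = 0"
      by (intro row_indepD[OF insert.prems(2), of "\<lambda>k. if k = i then 1 else 0" i]) auto
    then show False by simp
  qed
  then obtain j where j: "j \<in> J" "M y i j \<noteq> 0" by blast
  have "eventually (\<lambda>x. row_indep I J (\<lambda>k l. M x i j * M x k l - M x k j * M x i l)) F"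
  proof (rule insert.IH)
    show "row_indep I J (\<lambda>k l. M y i j * M y k l - M y k j * M y i l)"
      using row_indep_pivot[OF insert.hyps(1,2) j(1), of "M y"] j(2) insert.prems(2) by simp
    show "(\<lambda>x. M x i j * M x k l - M x k j * M x i l) \<in> R" if "k \<in> I" "l \<in> J" for k l
      by (intro closed insert.prems) (use that j in auto)
  qed
  moreover have "eventually (\<lambda>x. M x i j \<noteq> 0) F"
    using j insert.prems(1) by (intro nonzero) auto
  ultimately show ?case
  proof eventually_elim
    case (elim x)
    then show ?case using row_indep_pivot[OF insert.hyps(1,2) j(1), of "M x"] by simp
  qed
qed

text \<open>The filter is arbitrary because it is later the image of a sequence of placements or of
  a one-sided neighbourhood of time 0.\<close>

lemma row_indep_tendsto:
  fixes M :: "'x \<Rightarrow> 'i \<Rightarrow> 'j \<Rightarrow> real"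
  assumes "finite I" "\<And>i j. i \<in> I \<Longrightarrow> j \<in> J \<Longrightarrow> ((\<lambda>x. M x i j) \<longlongrightarrow> M x0 i j) F"
    and "row_indep I J (M x0)"
  shows "eventually (\<lambda>x. row_indep I J (M x)) F"
  by (rule row_indep_transfer[where R = "{f. (f \<longlongrightarrow> f x0) F}" and y = x0])
     (use assms in \<open>auto intro!: tendsto_intros dest: tendsto_imp_eventually_ne\<close>)

text \<open>Serves in two directions: a convenient placement \<open>q\<close> proves independence at
  the generic \<open>p\<close>, and a dependence at \<open>p\<close> persists at every other
  placement.\<close>

lemma row_indep_generic:
  fixes p q :: "'v \<Rightarrow> real ^ 'd::finite"
  assumes "generic_placement V p" "finite I"
    "\<And>i j. i \<in> I \<Longrightarrow> j \<in> J \<Longrightarrow> rational_polynomial_fun V (\<lambda>x. M x i j)"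
    and "row_indep I J (M q)"
  shows "row_indep I J (M p)"
proof -
  have "eventually (\<lambda>x. row_indep I J (M x)) (principal {p})"
    by (rule row_indep_transfer[where R = "{f. rational_polynomial_fun V f}" and y = q])
       (use assms in \<open>auto intro!: rational_polynomial_fun_diff rational_polynomial_fun_mult
          simp: eventually_principal dest: generic_placement_nonzero\<close>)
  then show ?thesis by (simp add: eventually_principal)
qed

text \<open>By induction on the rows. Unit vectors, corrected by the old dual vectors so that the
  old rows annihilate them, cannot all be annihilated by the new row, which would then be a
  combination of the old ones. One that is not annihilated is scaled to be dual to the new row and
  then used to correct the old dual vectors.\<close>

lemma row_indep_duals:
  assumes "finite I" "finite J" "row_indep I J M"
  obtains b where "\<And>i i'. i \<in> I \<Longrightarrow> i' \<in> I \<Longrightarrow> (\<Sum>j\<in>J. M i j * b i' j) = (if i = i' then 1 else 0)"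
proof -
  have "\<exists>b. \<forall>i\<in>I. \<forall>i'\<in>I. (\<Sum>j\<in>J. M i j * b i' j) = (if i = i' then 1 else 0)"
    using assms(1,3)
  proof (induction I)
    case empty
    then show ?case by simp
  next
    case (insert i I)
    have "row_indep I J M"
      unfolding row_indep_def
    proof (intro allI impI)
      fix c assume c: "\<forall>j\<in>J. (\<Sum>k\<in>I. c k * M k j) = 0"
      have "(\<Sum>k\<in>insert i I. (c(i := 0)) k * M k j) = (\<Sum>k\<in>I. c k * M k j)" for j
        by (rule sum.mono_neutral_cong_right) (use insert.hyps in auto)
      with c have "(c(i := 0)) k = 0" if "k \<in> I" for k
        using row_indepD[OF insert.prems, of "c(i := 0)" k] that by simp
      then show "\<forall>k\<in>I. c k = 0" using insert.hyps by (metis fun_upd_other)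
    qed
    then obtain b where b: "\<And>k k'. k \<in> I \<Longrightarrow> k' \<in> I \<Longrightarrow> (\<Sum>j\<in>J. M k j * b k' j) = (if k = k' then 1 else 0)"
      using insert.IH by blast
    \<comment> \<open>\<open>ap k w\<close> is row \<open>k\<close> applied to the column vector
      \<open>w\<close>.\<close>
    define ap where "ap k w = (\<Sum>j\<in>J. M k j * w j)" for k w
    have ap_diff: "ap k (\<lambda>j. w j - w' j) = ap k w - ap k w'" for k w w'
      by (simp add: ap_def right_diff_distrib sum_subtractf)
    have ap_scale: "ap k (\<lambda>j. c * w j) = c * ap k w" for k c w
      by (simp add: ap_def sum_distrib_left mult_ac)
    have ap_sum: "ap k (\<lambda>j. \<Sum>s\<in>I. c s * b s j) = (\<Sum>s\<in>I. c s * ap k (b s))" for k c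
      unfolding ap_def sum_distrib_left by (subst sum.swap) (simp add: mult_ac)
    have ap_ind: "ap k (\<lambda>j. if j = l then 1 else 0) = M k l" if "l \<in> J" for k l
      using assms(2) that by (simp add: ap_def sum.delta if_distrib[of "\<lambda>x. _ * x"] cong: if_cong)
    have apb: "ap k (b k') = (if k = k' then 1 else 0)" if "k \<in> I" "k' \<in> I" for k k'
      using b that by (simp add: ap_def)
    define w where "w l = (\<lambda>j. (if j = l then 1 else 0) - (\<Sum>s\<in>I. M s l * b s j))" for l
    have ap_w: "ap k (w l) = M k l - (\<Sum>s\<in>I. M s l * ap k (b s))" if "l \<in> J" for k l
      by (simp add: w_def ap_diff ap_sum ap_ind that)
    have w0: "ap k (w l) = 0" if "l \<in> J" "k \<in> I" for k l
    proof -
      have "(\<Sum>s\<in>I. M s l * ap k (b s)) = (\<Sum>s\<in>I. if k = s then M s l else 0)"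
        using that by (intro sum.cong) (auto simp: apb)
      then show ?thesis using that insert.hyps by (simp add: ap_w)
    qed
    have "\<exists>l\<in>J. ap i (w l) \<noteq> 0"
    proof (rule ccontr)
      assume "\<not> ?thesis"
      then have *: "M i l = (\<Sum>s\<in>I. M s l * ap i (b s))" if "l \<in> J" for l
        using ap_w[of l i] that by simp
      define c where "c k = (if k = i then 1 else - ap i (b k))" for k
      have "(\<Sum>k\<in>insert i I. c k * M k l) = 0" if "l \<in> J" for l
      proof -
        have "(\<Sum>k\<in>I. c k * M k l) = (\<Sum>k\<in>I. - (M k l * ap i (b k)))"
          using insert.hyps by (intro sum.cong) (auto simp: c_def)
        then show ?thesis using insert.hyps *[OF that] by (simp add: c_def sum_negf)
      qed
      then have "c i = 0" using row_indepD[OF insert.prems] by blast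
      then show False by (simp add: c_def)
    qed
    then obtain l where l: "l \<in> J" "ap i (w l) \<noteq> 0" by blast
    define w' where "w' = (\<lambda>j. (1 / ap i (w l)) * w l j)"
    have w': "ap i w' = 1" "\<And>k. k \<in> I \<Longrightarrow> ap k w' = 0"
      unfolding w'_def ap_scale using l w0 by auto
    define b' where "b' k = (if k = i then w' else (\<lambda>j. b k j - ap i (b k) * w' j))" for k
    have "ap k (b' k') = (if k = k' then 1 else 0)" if "k \<in> insert i I" "k' \<in> insert i I" for k k'
      using that insert.hyps by (auto simp: b'_def ap_diff ap_scale w' apb)
    then show ?case unfolding ap_def by blast
  qed
  then show ?thesis using that by blast
qed

section \<open>Infinitesimal rigidity\<close>

text \<open>Half the derivative of the squared length of the pair \<open>e\<close> when the points
  \<open>p\<close> move with velocities \<open>w\<close>, that is, the rigidity matrix applied to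
  \<open>w\<close>. The form is symmetric and bilinear in \<open>p\<close> and \<open>w\<close>, so
  midpoints and displacements can stand in either argument.\<close>

definition strain :: "('v \<Rightarrow> real ^ 'd::finite) \<Rightarrow> ('v \<Rightarrow> real ^ 'd) \<Rightarrow> 'v \<times> 'v \<Rightarrow> real" where
  "strain p w e = (p (fst e) - p (snd e)) \<bullet> (w (fst e) - w (snd e))"

text \<open>A row of the rigidity matrix, whose columns are pairs of a vertex and a coordinate. If
  both ends of \<open>e\<close> coincide, the row is zero.\<close>

definition strain_row :: "('v \<Rightarrow> real ^ 'd::finite) \<Rightarrow> 'v \<times> 'v \<Rightarrow> 'v \<times> 'd \<Rightarrow> real" where
  "strain_row p e j =
     (p (fst e) - p (snd e)) $ snd j * (of_bool (fst j = fst e) - of_bool (fst j = snd e))"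

lemma sum_coordinates:
  fixes a :: "real ^ 'd::finite"
  assumes "finite V" "u \<in> V"
  shows "(\<Sum>j\<in>V \<times> UNIV. a $ snd j * of_bool (fst j = u) * w (fst j) $ snd j) = a \<bullet> w u"
proof -
  have "(\<Sum>j\<in>V \<times> UNIV. a $ snd j * of_bool (fst j = u) * w (fst j) $ snd j)
    = (\<Sum>z\<in>V. \<Sum>c\<in>UNIV. a $ c * of_bool (z = u) * w z $ c)"
    by (simp add: sum.cartesian_product split_def)
  also have "\<dots> = (\<Sum>z\<in>V. if z = u then a \<bullet> w z else 0)"
    by (intro sum.cong) (auto simp: inner_vec_def)
  finally show ?thesis using assms by simp
qed

lemma strain_eq_sum:
  assumes "finite V" "fst e \<in> V" "snd e \<in> V"
  shows "strain p w e = (\<Sum>j\<in>V \<times> UNIV. strain_row p e j * w (fst j) $ snd j)"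
proof -
  let ?a = "p (fst e) - p (snd e)"
  have "(\<Sum>j\<in>V \<times> UNIV. strain_row p e j * w (fst j) $ snd j)
    = (\<Sum>j\<in>V \<times> UNIV. ?a $ snd j * of_bool (fst j = fst e) * w (fst j) $ snd j)
      - (\<Sum>j\<in>V \<times> UNIV. ?a $ snd j * of_bool (fst j = snd e) * w (fst j) $ snd j)"
    unfolding strain_row_def right_diff_distrib left_diff_distrib[of "_ * _"] sum_subtractf ..
  also have "\<dots> = strain p w e"
    unfolding sum_coordinates[OF assms(1,2)] sum_coordinates[OF assms(1,3)]
    by (simp add: strain_def inner_diff_right)
  finally show ?thesis ..
qed

lemma dist_eq_iff_strain_midpoint:
  fixes p q :: "'v \<Rightarrow> real ^ 'd::finite"
  shows
  "dist (q u) (q v) = dist (p u) (p v) \<longleftrightarrow>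
     strain (\<lambda>z. midpoint (p z) (q z)) (\<lambda>z. q z - p z) (u, v) = 0"
proof -
  have "(dist (q u) (q v))\<^sup>2 - (dist (p u) (p v))\<^sup>2
      = 2 * strain (\<lambda>z. midpoint (p z) (q z)) (\<lambda>z. q z - p z) (u, v)"
  proof -
    have "midpoint (p u) (q u) - midpoint (p v) (q v) = (1/2) *\<^sub>R ((p u - p v) + (q u - q v))"
      by (simp add: midpoint_def algebra_simps)
    moreover have "(q u - p u) - (q v - p v) = (q u - q v) - (p u - p v)"
      by simp
    moreover have "b \<bullet> b - a \<bullet> a = 2 * (((1/2) *\<^sub>R (a + b)) \<bullet> (b - a))" for a b :: "real ^ 'd"
      by (simp add: inner_add_right inner_diff_left inner_diff_right inner_commute)
    ultimately show ?thesis
      unfolding strain_def dist_norm power2_norm_eq_inner fst_conv snd_conv by presburger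
  qed
  then show ?thesis
    using power2_eq_iff_nonneg[of "dist (q u) (q v)" "dist (p u) (p v)"] by auto
qed

text \<open>A motion counts as trivial when it changes no distance between vertices of
  \<open>V\<close> to first order. This avoids an explicit description of the trivial
  motions.\<close>

definition inf_rigid :: "'v set \<Rightarrow> 'v set set \<Rightarrow> ('v \<Rightarrow> real ^ 'd::finite) \<Rightarrow> bool" where
  "inf_rigid V E p \<longleftrightarrow>
     (\<forall>w. (\<forall>u\<in>V. \<forall>v\<in>V. {u, v} \<in> E \<longrightarrow> strain p w (u, v) = 0) \<longrightarrow>
          (\<forall>u\<in>V. \<forall>v\<in>V. strain p w (u, v) = 0))"

lemma inf_rigidD:
  assumes "inf_rigid V E p" "\<And>u v. u \<in> V \<Longrightarrow> v \<in> V \<Longrightarrow> {u, v} \<in> E \<Longrightarrow> strain p w (u, v) = 0"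
    and "u \<in> V" "v \<in> V"
  shows "strain p w (u, v) = 0"
  using assms unfolding inf_rigid_def by blast

text \<open>The map \<open>\<sigma>\<close> is indexed by the coordinates only to have exactly \<open>CARD('d)\<close> values.\<close>

definition spanning_at :: "'v \<Rightarrow> ('d \<Rightarrow> 'v) \<Rightarrow> ('v \<Rightarrow> real ^ 'd::finite) \<Rightarrow> bool" where
  "spanning_at z \<sigma> p \<longleftrightarrow> (\<forall>w. (\<forall>i. w \<bullet> (p (\<sigma> i) - p z) = 0) \<longrightarrow> w = 0)"

text \<open>Gives spanning the form that the transfer lemmas accept: the coefficients of a
  dependence among the coordinate rows are the entries of a vector \<open>w\<close> orthogonal to
  all differences.\<close>

lemma spanning_at_row_indep:
  "spanning_at z \<sigma> p \<longleftrightarrow> row_indep UNIV UNIV (\<lambda>c i. (p (\<sigma> i) - p z) $ c)"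
proof
  assume l: "spanning_at z \<sigma> p"
  show "row_indep UNIV UNIV (\<lambda>c i. (p (\<sigma> i) - p z) $ c)"
    unfolding row_indep_def
  proof (intro allI impI)
    fix c assume c: "\<forall>j\<in>UNIV. (\<Sum>i\<in>UNIV. c i * (p (\<sigma> j) - p z) $ i) = 0"
    then have "(\<chi> i. c i) \<bullet> (p (\<sigma> i) - p z) = 0" for i
      by (simp add: inner_vec_def)
    then have "(\<chi> i. c i) = 0" using l by (simp add: spanning_at_def)
    then show "\<forall>i\<in>UNIV. c i = 0" by (simp add: vec_eq_iff)
  qed
next
  assume r: "row_indep UNIV UNIV (\<lambda>c i. (p (\<sigma> i) - p z) $ c)"
  show "spanning_at z \<sigma> p"
    unfolding spanning_at_def
  proof (intro allI impI)
    fix w assume "\<forall>i. w \<bullet> (p (\<sigma> i) - p z) = 0"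
    then have "w $ c = 0" for c
      using row_indepD[OF r, of "\<lambda>c. w $ c" c] by (simp add: inner_vec_def)
    then show "w = 0" by (simp add: vec_eq_iff)
  qed
qed

text \<open>Independence of polynomial rows passes from one placement to a generic one, so a single
  example suffices: \<open>q\<close> puts \<open>z\<close> at the origin and
  \<open>\<sigma> i\<close> at the \<open>i\<close>-th unit vector.\<close>

lemma generic_spanning_at:
  fixes p :: "'v \<Rightarrow> real ^ 'd::finite"
  assumes "generic_placement V p" "inj \<sigma>" "range \<sigma> \<subseteq> V" "z \<in> V - range \<sigma>"
  shows "spanning_at z \<sigma> p"
proof -
  define q :: "'v \<Rightarrow> real ^ 'd" where "q v = (if v = z then 0 else axis (inv \<sigma> v) 1)" for v
  have "spanning_at z \<sigma> q"
    using assms(2,4) by (auto simp: spanning_at_def q_def inner_axis vec_eq_iff)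
  then have "row_indep UNIV UNIV (\<lambda>c i. (q (\<sigma> i) - q z) $ c)"
    by (simp add: spanning_at_row_indep)
  then have "row_indep UNIV UNIV (\<lambda>c i. (p (\<sigma> i) - p z) $ c)"
    by (rule row_indep_generic[OF assms(1), rotated 2])
       (use assms in \<open>auto intro!: rational_polynomial_fun_diff rational_polynomial_fun_coord\<close>)
  then show ?thesis by (simp add: spanning_at_row_indep)
qed

text \<open>Spanning says that this matrix has trivial kernel, and the matrix is square because
  \<open>\<sigma>\<close> is indexed by the coordinates.\<close>

lemma spanning_at_inverse:
  assumes "spanning_at z \<sigma> p"
  obtains X where "X ** (\<chi> i. p (\<sigma> i) - p z) = mat 1" "(\<chi> i. p (\<sigma> i) - p z) ** X = mat 1"
proof -
  have "x = 0" if "(\<chi> i. p (\<sigma> i) - p z) *v x = 0" for x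
    using assms that by (auto simp: spanning_at_def vec_eq_iff matrix_vector_mul_component inner_commute)
  then obtain X where "X ** (\<chi> i. p (\<sigma> i) - p z) = mat 1"
    unfolding matrix_left_invertible_ker[symmetric] by (metis matrix_left_invertible_ker)
  then show ?thesis using that matrix_left_right_inverse by blast
qed

text \<open>By polarization, the differences from \<open>z\<close> have the same inner products in
  \<open>p\<close> and in \<open>q\<close>. Equality of the Gram matrices of \<open>X\<close> and
  \<open>Y\<close> makes \<open>B = X' ** Y\<close> orthogonal, and equality of the inner products
  with the other vertices gives the action of \<open>B\<close>.\<close>

lemma congruent_orthogonal_matrix:
  fixes p q :: "'v \<Rightarrow> real ^ 'd::finite"
  assumes "spanning_at z \<sigma> p" "z \<in> V" "range \<sigma> \<subseteq> V"
    and dist: "\<And>u v. u \<in> V \<Longrightarrow> v \<in> V \<Longrightarrow> dist (q u) (q v) = dist (p u) (p v)"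
  obtains B where "orthogonal_matrix B" "\<And>u. u \<in> V \<Longrightarrow> B *v (q u - q z) = p u - p z"
proof -
  define X where "X = (\<chi> i. p (\<sigma> i) - p z)"
  define Y where "Y = (\<chi> i. q (\<sigma> i) - q z)"
  have inner: "(q u - q z) \<bullet> (q v - q z) = (p u - p z) \<bullet> (p v - p z)" if "u \<in> V" "v \<in> V" for u v
  proof -
    have polar: "a \<bullet> b = ((norm a)\<^sup>2 + (norm b)\<^sup>2 - (norm (a - b))\<^sup>2) / 2" for a b :: "real ^ 'd"
      by (simp add: power2_norm_eq_inner inner_diff_left inner_diff_right inner_commute)
    show ?thesis
      using dist[OF that] dist[OF that(1) assms(2)] dist[OF that(2) assms(2)]
      unfolding polar[of "q u - q z"] polar[of "p u - p z"] by (simp add: dist_norm)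
  qed
  have \<sigma>: "\<sigma> i \<in> V" for i using assms(3) by auto
  obtain X' where X': "X' ** X = mat 1" "X ** X' = mat 1"
    using spanning_at_inverse[OF assms(1)] unfolding X_def by blast
  define B where "B = X' ** Y"
  have gram: "Y ** transpose Y = X ** transpose X"
    by (simp add: vec_eq_iff matrix_matrix_mult_def transpose_def X_def Y_def inner \<sigma>
        flip: inner_vec_def[where 'a = real, simplified])
       (use inner \<sigma> in \<open>simp add: inner_vec_def\<close>)
  have "B ** transpose B = X' ** (Y ** transpose Y) ** transpose X'"
    by (simp add: B_def matrix_transpose_mul matrix_mul_assoc)
  also have "\<dots> = (X' ** X) ** transpose (X' ** X)"
    by (simp add: gram matrix_transpose_mul matrix_mul_assoc)
  finally have "B ** transpose B = mat 1" by (simp add: X')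
  then have "orthogonal_matrix B"
    unfolding orthogonal_matrix_def using matrix_left_right_inverse by blast
  moreover have "B *v (q u - q z) = p u - p z" if "u \<in> V" for u
  proof -
    have "Y *v (q u - q z) = X *v (p u - p z)"
      using that by (simp add: vec_eq_iff matrix_vector_mul_component X_def Y_def inner \<sigma>)
    then have "B *v (q u - q z) = (X' ** X) *v (p u - p z)"
      by (simp add: B_def flip: matrix_vector_mul_assoc)
    then show ?thesis by (simp add: X')
  qed
  ultimately show ?thesis using that by blast
qed

section \<open>Infinitesimal rigidity versus rigidity\<close>

text \<open>The times at which the moving framework is congruent to \<open>p\<close> form a clopen
  subset of the unit interval. For openness, the placement at a time close to such a time is moved
  back near \<open>p\<close> by an isometry. Its midpoint with \<open>p\<close> has to be
  infinitesimally rigid, which is why this is assumed on a neighbourhood of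
  \<open>p\<close>.\<close>

lemma rigid_framework_if_inf_rigid_near:
  fixes p :: "'v \<Rightarrow> real ^ 'd::finite"
  assumes "finite V" "spanning_at z \<sigma> p" "z \<in> V" "range \<sigma> \<subseteq> V" "\<epsilon> > 0"
    and near: "\<And>x. (\<And>u. u \<in> V \<Longrightarrow> dist (x u) (p u) < \<epsilon>) \<Longrightarrow> inf_rigid V E x"
  shows "rigid_framework V E p"
  unfolding rigid_framework_def
proof (intro allI impI)
  fix q :: "'v \<Rightarrow> real \<Rightarrow> real ^ 'd"
  assume q: "(\<forall>v\<in>V. continuous_on {0..1} (q v) \<and> q v 0 = p v) \<and>
    (\<forall>t\<in>{0..1}. \<forall>u\<in>V. \<forall>v\<in>V. {u, v} \<in> E \<longrightarrow> dist (q u t) (q v t) = dist (p u) (p v))"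
  define S where "S = {t\<in>{0..1}. \<forall>u\<in>V. \<forall>v\<in>V. dist (q u t) (q v t) = dist (p u) (p v)}"
  \<comment> \<open>The single function \<open>h\<close> measures the total deviation from
    congruence, so that \<open>S\<close> is a zero set.\<close>
  define h where "h t = (\<Sum>u\<in>V. \<Sum>v\<in>V. \<bar>dist (q u t) (q v t) - dist (p u) (p v)\<bar>)" for t
  have "continuous_on {0..1} h"
    unfolding h_def using q by (intro continuous_intros) auto
  moreover have "S = {t\<in>{0..1}. h t = 0}"
    using assms(1) by (simp add: S_def h_def sum_nonneg_eq_0_iff sum_nonneg)
  ultimately have closed: "closedin (top_of_set {0..1}) S"
    by (simp only: continuous_closedin_preimage_constant)
  have "openin (top_of_set {0..1}) S"
    unfolding openin_euclidean_subtopology_iff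
  proof (intro conjI ballI)
    show "S \<subseteq> {0..1}" by (auto simp: S_def)
    fix s assume s: "s \<in> S"
    then obtain B where B: "orthogonal_matrix B" "\<And>u. u \<in> V \<Longrightarrow> B *v (q u s - q z s) = p u - p z"
      using congruent_orthogonal_matrix[OF assms(2-4), of "\<lambda>u. q u s"] unfolding S_def by blast
    have normB: "norm (B *v x) = norm x" for x
      using B(1) by (simp add: orthogonal_transformation_norm orthogonal_transformation_matrix)
    have "\<forall>u\<in>V. \<forall>\<^sub>F t in at s within {0..1}. dist (q u t) (q u s) < \<epsilon>"
      using q s assms(5) unfolding S_def continuous_on_def tendsto_iff by blast
    then have "\<forall>\<^sub>F t in at s within {0..1}. \<forall>u\<in>V. dist (q u t) (q u s) < \<epsilon>"
      using assms(1) by (simp add: eventually_ball_finite)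
    then obtain e where e: "e > 0" "\<And>t u. t \<in> {0..1} \<Longrightarrow> t \<noteq> s \<Longrightarrow> dist t s < e \<Longrightarrow> u \<in> V \<Longrightarrow> dist (q u t) (q u s) < \<epsilon>"
      unfolding eventually_at by blast
    have "t \<in> S" if t: "t \<in> {0..1}" "dist t s < e" for t
    proof -
      \<comment> \<open>\<open>r\<close> is the placement at time \<open>t\<close> followed by the
        isometry that takes the placement at time \<open>s\<close> to \<open>p\<close>.\<close>
      define r where "r u = p z + B *v (q u t - q z s)" for u
      have r_p: "r u - p u = B *v (q u t - q u s)" if "u \<in> V" for u
      proof -
        have "p u = p z + B *v (q u s - q z s)" using B(2)[OF that] by simp
        then show ?thesis
          by (simp add: r_def matrix_vector_mult_diff_distrib)
      qed
      have r_dist: "dist (r u) (r v) = dist (q u t) (q v t)" for u v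
      proof -
        have "r u - r v = B *v (q u t - q v t)"
          by (simp add: r_def matrix_vector_mult_diff_distrib)
        then show ?thesis by (simp add: dist_norm normB)
      qed
      have r_near: "dist (r u) (p u) < \<epsilon>" if "u \<in> V" for u
        using e(2)[OF t(1) _ t(2) that] assms(5) r_p[OF that]
        by (cases "t = s") (auto simp: dist_norm normB)
      have "inf_rigid V E (\<lambda>u. midpoint (p u) (r u))"
      proof (rule near)
        fix u assume "u \<in> V"
        then show "dist (midpoint (p u) (r u)) (p u) < \<epsilon>"
          using r_near[of u] assms(5) by (simp add: dist_midpoint dist_commute)
      qed
      moreover have "strain (\<lambda>u. midpoint (p u) (r u)) (\<lambda>u. r u - p u) (u, v) = 0"
        if "u \<in> V" "v \<in> V" "{u, v} \<in> E" for u v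
        unfolding dist_eq_iff_strain_midpoint[symmetric] r_dist using q t that by blast
      ultimately have "strain (\<lambda>u. midpoint (p u) (r u)) (\<lambda>u. r u - p u) (u, v) = 0"
        if "u \<in> V" "v \<in> V" for u v
        using that by (rule inf_rigidD)
      then have "dist (q u t) (q v t) = dist (p u) (p v)" if "u \<in> V" "v \<in> V" for u v
        unfolding dist_eq_iff_strain_midpoint[symmetric] r_dist using that by blast
      then show "t \<in> S"
        using t by (simp add: S_def)
    qed
    then show "\<exists>e>0. \<forall>x'\<in>{0..1}. dist x' s < e \<longrightarrow> x' \<in> S" using e(1) by blast
  qed
  moreover have "0 \<in> S" using q by (auto simp: S_def)
  moreover have "connected {0..1::real}" by simp
  ultimately have "S = {0..1}"
    using closed unfolding connected_clopen by blast
  then show "\<forall>t\<in>{0..1}. \<forall>u\<in>V. \<forall>v\<in>V. dist (q u t) (q v t) = dist (p u) (p v)"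
    by (auto simp: S_def)
qed

section \<open>Openness of infinitesimal rigidity\<close>

text \<open>The normalisation selects one representative from each class of infinitesimal motions modulo
  trivial ones: it fixes \<open>z\<close> and forces the linear map taking each \<open>p (\<sigma> i) - p z\<close> to \<open>w (\<sigma> i)\<close>
  to be symmetric.\<close>

definition normalised_motion ::
    "'v \<Rightarrow> ('d \<Rightarrow> 'v) \<Rightarrow> ('v \<Rightarrow> real ^ 'd::finite) \<Rightarrow> ('v \<Rightarrow> real ^ 'd) \<Rightarrow> bool" where
  "normalised_motion z \<sigma> p w \<longleftrightarrow>
     w z = 0 \<and> (\<forall>a b. (p (\<sigma> a) - p z) \<bullet> w (\<sigma> b) = (p (\<sigma> b) - p z) \<bullet> w (\<sigma> a))"

text \<open>Subtracting a translation and an infinitesimal rotation changes no strain. With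
  \<open>M\<close> the linear map that sends \<open>p (\<sigma> i) - p z\<close> to
  \<open>w (\<sigma> i) - w z\<close>, the rotation removed is its skew part \<open>A\<close>, and
  its symmetric part remains.\<close>

lemma normalised_motion_exists:
  fixes p w :: "'v \<Rightarrow> real ^ 'd::finite"
  assumes "spanning_at z \<sigma> p"
  obtains w' where "normalised_motion z \<sigma> p w'" "\<And>e. strain p w' e = strain p w e"
proof -
  define X where "X = (\<chi> i. p (\<sigma> i) - p z)"
  define W where "W = (\<chi> i. w (\<sigma> i) - w z)"
  obtain X' where X': "X' ** X = mat 1" "X ** X' = mat 1"
    using spanning_at_inverse[OF assms] unfolding X_def by blast
  define M where "M = transpose (X' ** W)"
  define A where "A = (1/2) *\<^sub>R (M - transpose M)"
  have adj: "x \<bullet> (transpose M *v y) = (M *v x) \<bullet> y" for x y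
    by (metis dot_lmul_matrix transpose_matrix_vector transpose_transpose)
  have A: "A *v x = (1/2) *\<^sub>R (M *v x - transpose M *v x)" for x
    by (simp add: A_def matrix_vector_mult_diff_rdistrib scaleR_matrix_vector_assoc[symmetric])
  have M: "M *v (p (\<sigma> i) - p z) = w (\<sigma> i) - w z" for i
  proof -
    have x: "transpose X *v axis i 1 = p (\<sigma> i) - p z" and y: "transpose W *v axis i 1 = w (\<sigma> i) - w z"
      by (simp_all add: matrix_vector_mul_component vec_eq_iff inner_axis transpose_def X_def W_def)
    have "M ** transpose X = transpose W"
      unfolding M_def matrix_transpose_mul[symmetric] by (simp add: matrix_mul_assoc X')
    then have "M *v (transpose X *v axis i 1) = transpose W *v axis i 1"
      by (metis matrix_vector_mul_assoc)
    then show ?thesis by (simp only: x y)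
  qed
  have skew: "x \<bullet> (A *v x) = 0" for x
    unfolding A by (simp only: inner_scaleR_right inner_diff_right adj) (simp add: inner_commute)
  define w' where "w' u = w u - w z - A *v (p u - p z)" for u
  have "strain p w' e = strain p w e" for e
  proof -
    have "w' (fst e) - w' (snd e) = w (fst e) - w (snd e) - A *v (p (fst e) - p (snd e))"
      by (simp add: w'_def matrix_vector_mult_diff_distrib)
    then show ?thesis by (simp add: strain_def inner_diff_right skew)
  qed
  moreover have "normalised_motion z \<sigma> p w'"
    unfolding normalised_motion_def
  proof (intro conjI allI)
    show "w' z = 0" by (simp add: w'_def)
    have w': "w' (\<sigma> b) = (1/2) *\<^sub>R (M *v (p (\<sigma> b) - p z) + transpose M *v (p (\<sigma> b) - p z))" for b
      unfolding w'_def A M[symmetric] by (simp add: algebra_simps flip: scaleR_2[of "M *v (p (\<sigma> b) - p z)"])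
    show "(p (\<sigma> a) - p z) \<bullet> w' (\<sigma> b) = (p (\<sigma> b) - p z) \<bullet> w' (\<sigma> a)" for a b
      unfolding w' by (simp only: inner_scaleR_right inner_add_right adj) (simp add: inner_commute)
  qed
  ultimately show ?thesis using that by blast
qed

text \<open>Unlike in infinitesimal rigidity, the conclusion is \<open>w = 0\<close> on
  \<open>V\<close>: a homogeneous linear system has trivial kernel. In this form the property is an
  independence of rows.\<close>

definition normalised_rigid ::
    "'v set \<Rightarrow> 'v set set \<Rightarrow> 'v \<Rightarrow> ('d \<Rightarrow> 'v) \<Rightarrow> ('v \<Rightarrow> real ^ 'd::finite) \<Rightarrow> bool" where
  "normalised_rigid V E z \<sigma> p \<longleftrightarrow>
     (\<forall>w. normalised_motion z \<sigma> p w \<longrightarrow>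
        (\<forall>u\<in>V. \<forall>v\<in>V. {u, v} \<in> E \<longrightarrow> strain p w (u, v) = 0) \<longrightarrow> (\<forall>u\<in>V. w u = 0))"

text \<open>If \<open>w z = 0\<close> and all strains vanish, expanding them shows that
  \<open>(p u - p z) \<bullet> w v\<close> is antisymmetric in \<open>u\<close> and
  \<open>v\<close>, whereas normalisation makes it symmetric on the vertices
  \<open>\<sigma> i\<close>. Hence it vanishes there, and spanning gives first
  \<open>w (\<sigma> b) = 0\<close> and then \<open>w u = 0\<close>. The converse replaces a motion
  by its normalised form.\<close>

lemma inf_rigid_iff_normalised_rigid:
  fixes p :: "'v \<Rightarrow> real ^ 'd::finite"
  assumes sp: "spanning_at z \<sigma> p" and V: "z \<in> V" "range \<sigma> \<subseteq> V"
  shows "inf_rigid V E p \<longleftrightarrow> normalised_rigid V E z \<sigma> p"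
proof
  assume rigid: "inf_rigid V E p"
  show "normalised_rigid V E z \<sigma> p"
    unfolding normalised_rigid_def
  proof (intro allI impI)
    fix w assume w: "normalised_motion z \<sigma> p w" "\<forall>u\<in>V. \<forall>v\<in>V. {u, v} \<in> E \<longrightarrow> strain p w (u, v) = 0"
    have str: "strain p w (u, v) = 0" if "u \<in> V" "v \<in> V" for u v
      using inf_rigidD[OF rigid] w(2) that by blast
    have wz: "w z = 0" using w(1) by (simp add: normalised_motion_def)
    have \<sigma>: "\<sigma> i \<in> V" for i using V by auto
    have self: "(p u - p z) \<bullet> w u = 0" if "u \<in> V" for u
      using str[OF that V(1)] by (simp add: strain_def wz)
    have pair: "(p u - p z) \<bullet> w v + (p v - p z) \<bullet> w u = 0" if "u \<in> V" "v \<in> V" for u v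
    proof -
      have "strain p w (u, v) = (p u - p z) \<bullet> w u + (p v - p z) \<bullet> w v
          - ((p u - p z) \<bullet> w v + (p v - p z) \<bullet> w u)"
        by (simp add: strain_def inner_diff_left inner_diff_right)
      then show ?thesis using str that self by simp
    qed
    have "w (\<sigma> b) \<bullet> (p (\<sigma> a) - p z) = 0" for a b
      using pair[OF \<sigma> \<sigma>, of a b] w(1) by (simp add: normalised_motion_def inner_commute)
    then have w\<sigma>: "w (\<sigma> b) = 0" for b
      using sp unfolding spanning_at_def by blast
    show "\<forall>u\<in>V. w u = 0"
    proof
      fix u assume u: "u \<in> V"
      have "w u \<bullet> (p (\<sigma> a) - p z) = 0" for a
        using pair[OF \<sigma> u, of a] by (simp add: w\<sigma> inner_commute)
      then show "w u = 0" using sp unfolding spanning_at_def by blast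
    qed
  qed
next
  assume rigid: "normalised_rigid V E z \<sigma> p"
  show "inf_rigid V E p"
    unfolding inf_rigid_def
  proof (intro allI impI ballI)
    fix w u v
    assume w: "\<forall>u\<in>V. \<forall>v\<in>V. {u, v} \<in> E \<longrightarrow> strain p w (u, v) = 0" and uv: "u \<in> V" "v \<in> V"
    obtain w' where w': "normalised_motion z \<sigma> p w'" "\<And>e. strain p w' e = strain p w e"
      using normalised_motion_exists[OF sp] by blast
    then have "\<forall>u\<in>V. w' u = 0"
      using rigid w unfolding normalised_rigid_def by auto
    then have "strain p w' (u, v) = 0" using uv by (simp add: strain_def)
    then show "strain p w (u, v) = 0" using w'(2) by simp
  qed
qed

text \<open>The linear system for normalised motions, transposed so that a trivial kernel becomes
  independence of rows: rows are the unknown coordinates of \<open>w\<close>, columns the equations,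
  namely zero strain on pairs, \<open>w z = 0\<close> and the symmetry conditions.\<close>

definition normalised_rigid_row ::
    "'v \<Rightarrow> ('d \<Rightarrow> 'v) \<Rightarrow> ('v \<Rightarrow> real ^ 'd::finite) \<Rightarrow> 'v \<times> 'd \<Rightarrow> ('v \<times> 'v) + ('d + 'd \<times> 'd) \<Rightarrow> real" where
  "normalised_rigid_row z \<sigma> p j k = (case k of
      Inl e \<Rightarrow> strain_row p e j
    | Inr (Inl c) \<Rightarrow> axis c 1 $ snd j * of_bool (fst j = z)
    | Inr (Inr (a, b)) \<Rightarrow> (p (\<sigma> a) - p z) $ snd j * of_bool (fst j = \<sigma> b)
                        - (p (\<sigma> b) - p z) $ snd j * of_bool (fst j = \<sigma> a))"

lemma normalised_rigid_row_indep:
  fixes p :: "'v \<Rightarrow> real ^ 'd::finite"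
  assumes V: "finite V" "z \<in> V" "range \<sigma> \<subseteq> V"
  shows "normalised_rigid V E z \<sigma> p \<longleftrightarrow>
    row_indep (V \<times> UNIV) (Inl ` {(u, v). u \<in> V \<and> v \<in> V \<and> {u, v} \<in> E} \<union> range Inr) (normalised_rigid_row z \<sigma> p)"
proof -
  let ?F = "{(u, v). u \<in> V \<and> v \<in> V \<and> {u, v} \<in> E}"
  have \<sigma>: "\<sigma> i \<in> V" for i using V by auto
  \<comment> \<open>\<open>S w k\<close> is the left-hand side of equation \<open>k\<close> at the
    motion \<open>w\<close>.\<close>
  define S where "S w k = (\<Sum>j\<in>V \<times> UNIV. w (fst j) $ snd j * normalised_rigid_row z \<sigma> p j k)" for w :: "'v \<Rightarrow> real ^ 'd" and k
  have S_Inl: "S w (Inl (u, v)) = strain p w (u, v)" if "u \<in> V" "v \<in> V" for w u v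
    using that V(1) by (simp add: S_def normalised_rigid_row_def strain_eq_sum mult_ac)
  have S_z: "S w (Inr (Inl c)) = w z $ c" for w c
    using sum_coordinates[OF V(1,2), of "axis c 1" w]
    by (simp add: S_def normalised_rigid_row_def mult_ac inner_axis')
  have S_sym: "S w (Inr (Inr (a, b))) = (p (\<sigma> a) - p z) \<bullet> w (\<sigma> b) - (p (\<sigma> b) - p z) \<bullet> w (\<sigma> a)" for w a b
    using sum_coordinates[OF V(1) \<sigma>[of b], of "p (\<sigma> a) - p z" w] sum_coordinates[OF V(1) \<sigma>[of a], of "p (\<sigma> b) - p z" w]
    unfolding S_def normalised_rigid_row_def
    by (simp add: right_diff_distrib sum_subtractf mult_ac del: vector_minus_component)
  have S: "(\<forall>k\<in>Inl ` ?F \<union> range Inr. S w k = 0) \<longleftrightarrow>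
      normalised_motion z \<sigma> p w \<and> (\<forall>u\<in>V. \<forall>v\<in>V. {u, v} \<in> E \<longrightarrow> strain p w (u, v) = 0)" (is "?l \<longleftrightarrow> ?r") for w
  proof
    assume l: ?l
    have "S w (Inr (Inl c)) = 0" for c using l by blast
    then have "w z = 0" by (simp add: vec_eq_iff S_z)
    moreover have "(p (\<sigma> a) - p z) \<bullet> w (\<sigma> b) - (p (\<sigma> b) - p z) \<bullet> w (\<sigma> a) = 0" for a b
      using l S_sym[of w a b] by (simp add: ball_Un)
    moreover have "strain p w (u, v) = 0" if "u \<in> V" "v \<in> V" "{u, v} \<in> E" for u v
      using l S_Inl[of u v w] that by (simp add: ball_Un)
    ultimately show ?r by (simp add: normalised_motion_def)
  next
    assume r: ?r
    show ?l
    proof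
      fix k :: "('v \<times> 'v) + ('d + 'd \<times> 'd)" assume "k \<in> Inl ` ?F \<union> range Inr"
      then consider u v where "k = Inl (u, v)" "u \<in> V" "v \<in> V" "{u, v} \<in> E"
        | c where "k = Inr (Inl c)" | a b where "k = Inr (Inr (a, b))"
        by (auto, metis sum.exhaust surj_pair)
      then show "S w k = 0"
        using r by cases (auto simp: S_Inl S_z S_sym normalised_motion_def)
    qed
  qed
  show ?thesis
  proof
    assume rigid: "normalised_rigid V E z \<sigma> p"
    show "row_indep (V \<times> UNIV) (Inl ` ?F \<union> range Inr) (normalised_rigid_row z \<sigma> p)"
      unfolding row_indep_def
    proof (intro allI impI)
      fix c assume c: "\<forall>k\<in>Inl ` ?F \<union> range Inr. (\<Sum>j\<in>V \<times> UNIV. c j * normalised_rigid_row z \<sigma> p j k) = 0"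
      define w where "w v = (\<chi> i. c (v, i))" for v
      have "\<forall>k\<in>Inl ` ?F \<union> range Inr. S w k = 0" using c by (simp add: S_def w_def)
      then have "\<forall>u\<in>V. w u = 0" using rigid S unfolding normalised_rigid_def by blast
      then show "\<forall>j\<in>V \<times> UNIV. c j = 0" by (auto simp: w_def vec_eq_iff)
    qed
  next
    assume ind: "row_indep (V \<times> UNIV) (Inl ` ?F \<union> range Inr) (normalised_rigid_row z \<sigma> p)"
    show "normalised_rigid V E z \<sigma> p"
      unfolding normalised_rigid_def
    proof (intro allI impI ballI)
      fix w u assume "normalised_motion z \<sigma> p w" "\<forall>u\<in>V. \<forall>v\<in>V. {u, v} \<in> E \<longrightarrow> strain p w (u, v) = 0"
        and u: "u \<in> V"
      then have "S w k = 0" if "k \<in> Inl ` ?F \<union> range Inr" for k using S that by blast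
      then have "w (fst (u, c)) $ snd (u, c) = 0" for c
        by (intro row_indepD[OF ind, of "\<lambda>j. w (fst j) $ snd j"]) (use u in \<open>auto simp: S_def\<close>)
      then show "w u = 0" by (simp add: vec_eq_iff)
    qed
  qed
qed

text \<open>A sequence of counterexamples converging to \<open>p\<close> on \<open>V\<close> would
  contradict the transfer of row independence along its image filter. Working with a sequence avoids
  a topology on placements, whose values off \<open>V\<close> are arbitrary.\<close>

lemma inf_rigid_near:
  fixes p :: "'v \<Rightarrow> real ^ 'd::finite"
  assumes V: "finite V" "z \<in> V" "range \<sigma> \<subseteq> V" and sp: "spanning_at z \<sigma> p" and rigid: "inf_rigid V E p"
  shows "\<exists>\<epsilon>>0. \<forall>q. (\<forall>u\<in>V. dist (q u) (p u) < \<epsilon>) \<longrightarrow> spanning_at z \<sigma> q \<and> inf_rigid V E q"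
proof (rule ccontr)
  assume "\<not> ?thesis"
  then have "\<exists>q. (\<forall>u\<in>V. dist (q u) (p u) < inverse (real (Suc n))) \<and> \<not> (spanning_at z \<sigma> q \<and> inf_rigid V E q)" for n
    by (metis inverse_positive_iff_positive of_nat_0_less_iff zero_less_Suc)
  then obtain q where near: "\<And>n u. u \<in> V \<Longrightarrow> dist (q n u) (p u) < inverse (real (Suc n))"
    and bad: "\<And>n. \<not> (spanning_at z \<sigma> (q n) \<and> inf_rigid V E (q n))"
    by metis
  have lim: "(\<lambda>n. q n u) \<longlonglongrightarrow> p u" if "u \<in> V" for u
  proof (rule metric_tendsto_imp_tendsto[OF LIMSEQ_inverse_real_of_nat])
    show "\<forall>\<^sub>F n in sequentially. dist (q n u) (p u) \<le> dist (inverse (real (Suc n))) 0"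
      using near[OF that] by (intro always_eventually allI) (simp add: less_imp_le)
  qed
  define F where "F = filtermap q sequentially"
  have limF: "((\<lambda>x. x u $ c) \<longlongrightarrow> p u $ c) F" if "u \<in> V" for u c
    using lim[OF that] by (simp add: F_def filterlim_filtermap tendsto_vec_nth)
  have \<sigma>: "\<sigma> i \<in> V" for i using V by auto
  have 1: "\<forall>\<^sub>F x in F. spanning_at z \<sigma> x"
    unfolding spanning_at_row_indep
    by (rule row_indep_tendsto[of _ _ _ p])
       (use sp V \<sigma> in \<open>auto simp: spanning_at_row_indep intro!: tendsto_intros limF\<close>)
  have "\<forall>\<^sub>F x in F. normalised_rigid V E z \<sigma> x"
    unfolding normalised_rigid_row_indep[OF V]
  proof (rule row_indep_tendsto[of _ _ _ p])
    show "row_indep (V \<times> UNIV) (Inl ` {(u, v). u \<in> V \<and> v \<in> V \<and> {u, v} \<in> E} \<union> range Inr) (normalised_rigid_row z \<sigma> p)"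
      using rigid by (simp add: inf_rigid_iff_normalised_rigid[OF sp V(2,3)] normalised_rigid_row_indep[OF V])
    fix j :: "'v \<times> 'd" and k :: "('v \<times> 'v) + ('d + 'd \<times> 'd)"
    assume "j \<in> V \<times> UNIV" "k \<in> Inl ` {(u, v). u \<in> V \<and> v \<in> V \<and> {u, v} \<in> E} \<union> range Inr"
    then show "((\<lambda>x. normalised_rigid_row z \<sigma> x j k) \<longlongrightarrow> normalised_rigid_row z \<sigma> p j k) F"
      using V(2) \<sigma> by (auto simp: normalised_rigid_row_def strain_row_def split: sum.splits
          intro!: tendsto_intros limF)
  qed (use V in auto)
  with 1 have "\<forall>\<^sub>F x in F. spanning_at z \<sigma> x \<and> inf_rigid V E x"
    by eventually_elim (simp add: inf_rigid_iff_normalised_rigid[OF _ V(2,3)])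
  then show False
    using bad by (simp add: F_def eventually_filtermap)
qed

section \<open>Flexes of generic frameworks that are not infinitesimally rigid\<close>

text \<open>Picard iteration from 0 with the time \<open>t\<close> as a parameter. For small
  \<open>t\<close> it stays in the ball of radius \<open>2 * L * t\<^sup>2\<close>, where the map
  contracts by the factor 1/2. Convergence is uniform in \<open>t\<close>, so the fixed point
  depends continuously on \<open>t\<close>.\<close>

lemma small_fixed_point:
  fixes \<Phi> :: "real \<Rightarrow> ('e \<Rightarrow> real) \<Rightarrow> 'e \<Rightarrow> real"
  assumes "finite S" "L > 0"
    and zero: "\<And>t e. t \<ge> 0 \<Longrightarrow> e \<in> S \<Longrightarrow> \<bar>\<Phi> t (\<lambda>_. 0) e\<bar> \<le> L * t\<^sup>2"
    and lipschitz: "\<And>t r s y y' e. t \<ge> 0 \<Longrightarrow> e \<in> S \<Longrightarrow> (\<And>e. e \<in> S \<Longrightarrow> \<bar>y e\<bar> \<le> r) \<Longrightarrow>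
      (\<And>e. e \<in> S \<Longrightarrow> \<bar>y' e\<bar> \<le> r) \<Longrightarrow> (\<And>e. e \<in> S \<Longrightarrow> \<bar>y e - y' e\<bar> \<le> s) \<Longrightarrow>
      \<bar>\<Phi> t y e - \<Phi> t y' e\<bar> \<le> L * (t + r) * s"
    and cont: "\<And>A y e. (\<And>e. e \<in> S \<Longrightarrow> continuous_on A (y e)) \<Longrightarrow> e \<in> S \<Longrightarrow>
      continuous_on A (\<lambda>t. \<Phi> t (\<lambda>e. y e t) e)"
  obtains \<tau> y where "\<tau> > 0" "\<And>e. e \<in> S \<Longrightarrow> continuous_on {0..\<tau>} (y e)"
    "\<And>t e. t \<in> {0..\<tau>} \<Longrightarrow> e \<in> S \<Longrightarrow> \<bar>y e t\<bar> \<le> 2 * L * t\<^sup>2"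
    "\<And>t e. t \<in> {0..\<tau>} \<Longrightarrow> e \<in> S \<Longrightarrow> \<Phi> t (\<lambda>e. y e t) e = y e t"
proof -
  \<comment> \<open>\<open>\<tau> \<le> 1\<close> gives \<open>t\<^sup>2 \<le> t\<close>, and the
    second bound then makes the Lipschitz factor \<open>L * (t + 2 * L * t\<^sup>2)\<close> at most
    1/2.\<close>
  define \<tau> where "\<tau> = min 1 (1 / (2 * L * (1 + 2 * L)))"
  have "\<tau> > 0" using assms(2) by (simp add: \<tau>_def)
  have contr: "L * (t + 2 * L * t\<^sup>2) \<le> 1 / 2" if "t \<in> {0..\<tau>}" for t
  proof -
    have t: "0 \<le> t" "t \<le> 1" "t \<le> 1 / (2 * L * (1 + 2 * L))" using that by (auto simp: \<tau>_def)
    have "t\<^sup>2 \<le> t" using t by (simp add: power2_eq_square mult_left_le)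
    then have "2 * L * t\<^sup>2 \<le> 2 * L * t" using assms(2) by simp
    then have "L * (t + 2 * L * t\<^sup>2) \<le> L * (t + 2 * L * t)" using assms(2) by simp
    also have "\<dots> = (L * (1 + 2 * L)) * t" by (simp add: algebra_simps)
    also have "\<dots> \<le> (L * (1 + 2 * L)) * (1 / (2 * L * (1 + 2 * L)))"
      using t assms(2) by (intro mult_left_mono) auto
    also have "\<dots> = 1 / 2"
      using assms(2) by (simp add: field_simps add_nonneg_eq_0_iff)
    finally show ?thesis .
  qed
  define Y where "Y = rec_nat (\<lambda>e t. 0) (\<lambda>_ y e t. \<Phi> t (\<lambda>e. y e t) e)"
  have Y0: "Y 0 = (\<lambda>e t. 0)" and YS: "Y (Suc n) = (\<lambda>e t. \<Phi> t (\<lambda>e. Y n e t) e)" for n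
    by (simp_all add: Y_def)
  have bounds: "\<forall>e\<in>S. \<bar>Y n e t\<bar> \<le> 2 * L * t\<^sup>2 * (1 - (1/2) ^ n) \<and> \<bar>Y (Suc n) e t - Y n e t\<bar> \<le> L * t\<^sup>2 * (1/2) ^ n"
    if t: "t \<in> {0..\<tau>}" for n t
  proof (induction n)
    case 0
    then show ?case using zero t by (simp add: Y0 YS)
  next
    case (Suc n)
    let ?r = "2 * L * t\<^sup>2"
    have r: "?r * (1 - (1/2) ^ k) \<le> ?r" for k :: nat
      using assms(2) by (intro mult_left_le) auto
    have A: "\<bar>Y (Suc n) e t\<bar> \<le> ?r * (1 - (1/2) ^ Suc n)" if "e \<in> S" for e
    proof -
      have "\<bar>Y (Suc n) e t\<bar> \<le> \<bar>Y n e t\<bar> + \<bar>Y (Suc n) e t - Y n e t\<bar>" by linarith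
      also have "\<dots> \<le> ?r * (1 - (1/2) ^ n) + L * t\<^sup>2 * (1/2) ^ n" using Suc that by (meson add_mono)
      also have "\<dots> = ?r * (1 - (1/2) ^ Suc n)" by (simp add: algebra_simps)
      finally show ?thesis .
    qed
    have B: "\<bar>Y (Suc (Suc n)) e t - Y (Suc n) e t\<bar> \<le> L * t\<^sup>2 * (1/2) ^ Suc n" if "e \<in> S" for e
    proof -
      have "\<bar>\<Phi> t (\<lambda>e. Y (Suc n) e t) e - \<Phi> t (\<lambda>e. Y n e t) e\<bar> \<le> L * (t + ?r) * (L * t\<^sup>2 * (1/2) ^ n)"
      proof (rule lipschitz)
        show "\<bar>Y (Suc n) e t\<bar> \<le> ?r" if "e \<in> S" for e
          using A[OF that] r[of "Suc n"] by linarith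
        show "\<bar>Y n e t\<bar> \<le> ?r" if "e \<in> S" for e
          using Suc that r[of n] by (meson order_trans)
        show "\<bar>Y (Suc n) e t - Y n e t\<bar> \<le> L * t\<^sup>2 * (1/2) ^ n" if "e \<in> S" for e
          using Suc that by blast
      qed (use t that in auto)
      also have "\<dots> \<le> 1/2 * (L * t\<^sup>2 * (1/2) ^ n)"
        using contr[OF t] assms(2) by (intro mult_right_mono) auto
      finally show ?thesis by (simp add: YS[of "Suc n"] YS[of n])
    qed
    show ?case using A B by blast
  qed
  \<comment> \<open>The limit is written as the telescoping series of the iterates, which the
    Weierstrass test majorises by \<open>L * (1/2) ^ n\<close>.\<close>
  define y where "y e t = suminf (\<lambda>n. Y (Suc n) e t - Y n e t)" for e t
  have ulim: "uniform_limit {0..\<tau>} (\<lambda>n. Y n e) (y e) sequentially" if e: "e \<in> S" for e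
  proof -
    have "uniform_limit {0..\<tau>} (\<lambda>n t. \<Sum>i<n. Y (Suc i) e t - Y i e t) (y e) sequentially"
      unfolding y_def
    proof (rule Weierstrass_m_test)
      fix n t assume t: "t \<in> {0..\<tau>}"
      then have "t\<^sup>2 \<le> 1" by (auto simp: \<tau>_def power_le_one)
      then have "L * t\<^sup>2 * (1/2) ^ n \<le> L * 1 * (1/2) ^ n"
        using assms(2) by (intro mult_right_mono mult_left_mono) auto
      then show "norm (Y (Suc n) e t - Y n e t) \<le> L * (1/2) ^ n"
        using bounds[OF t, of n] e by fastforce
    next
      show "summable (\<lambda>n. L * (1/2) ^ n)" by (intro summable_mult summable_geometric) simp
    qed
    moreover have "(\<lambda>n t. \<Sum>i<n. Y (Suc i) e t - Y i e t) = (\<lambda>n. Y n e)"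
      by (intro ext) (simp add: sum_lessThan_telescope[where f = "\<lambda>i. Y i e _"] Y0)
    ultimately show ?thesis by simp
  qed
  have lim: "(\<lambda>n. Y n e t) \<longlonglongrightarrow> y e t" if "e \<in> S" "t \<in> {0..\<tau>}" for e t
    using tendsto_uniform_limitI[OF ulim] that by blast
  have contY: "continuous_on {0..\<tau>} (Y n e)" if "e \<in> S" for n e
    using that
  proof (induction n arbitrary: e)
    case 0
    then show ?case by (simp add: Y0)
  next
    case (Suc n)
    then show ?case unfolding YS by (intro cont) auto
  qed
  have ybound: "\<bar>y e t\<bar> \<le> 2 * L * t\<^sup>2" and Ybound: "\<bar>Y n e t\<bar> \<le> 2 * L * t\<^sup>2"
    if "t \<in> {0..\<tau>}" "e \<in> S" for t e n
  proof -
    have *: "\<bar>Y n e t\<bar> \<le> 2 * L * t\<^sup>2" for n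
    proof -
      have "\<bar>Y n e t\<bar> \<le> 2 * L * t\<^sup>2 * (1 - (1/2) ^ n)" using bounds[OF that(1)] that(2) by blast
      also have "\<dots> \<le> 2 * L * t\<^sup>2" using assms(2) by (intro mult_left_le) auto
      finally show ?thesis .
    qed
    then show "\<bar>Y n e t\<bar> \<le> 2 * L * t\<^sup>2" .
    show "\<bar>y e t\<bar> \<le> 2 * L * t\<^sup>2"
      by (rule tendsto_upperbound[OF tendsto_rabs[OF lim[OF that(2,1)]]]) (use * in auto)
  qed
  show ?thesis
  proof (rule that[OF \<open>\<tau> > 0\<close>, of y])
    show "continuous_on {0..\<tau>} (y e)" if "e \<in> S" for e
      by (rule uniform_limit_theorem[OF _ ulim]) (use contY that in auto)
    show "\<bar>y e t\<bar> \<le> 2 * L * t\<^sup>2" if "t \<in> {0..\<tau>}" "e \<in> S" for t e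
      using ybound that by blast
    show "\<Phi> t (\<lambda>e. y e t) e = y e t" if t: "t \<in> {0..\<tau>}" and e: "e \<in> S" for t e
    proof -
      \<comment> \<open>\<open>s n\<close> bounds the errors of all components at once, as the
        Lipschitz hypothesis demands.\<close>
      define s where "s n = (\<Sum>e\<in>S. \<bar>Y n e t - y e t\<bar>)" for n
      have "s \<longlonglongrightarrow> (\<Sum>e\<in>S. \<bar>y e t - y e t\<bar>)"
        unfolding s_def by (intro tendsto_intros lim t)
      then have "(\<lambda>n. L * (t + 2 * L * t\<^sup>2) * s n) \<longlonglongrightarrow> 0"
        by (auto intro: tendsto_mult_right_zero)
      moreover have "\<bar>\<Phi> t (\<lambda>e. Y n e t) e - \<Phi> t (\<lambda>e. y e t) e\<bar> \<le> L * (t + 2 * L * t\<^sup>2) * s n" for n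
      proof (rule lipschitz)
        show "\<bar>Y n k t - y k t\<bar> \<le> s n" if "k \<in> S" for k
          unfolding s_def by (rule member_le_sum[OF that]) (use assms(1) in auto)
      qed (use t e ybound Ybound in auto)
      ultimately have "(\<lambda>n. \<Phi> t (\<lambda>e. Y n e t) e - \<Phi> t (\<lambda>e. y e t) e) \<longlonglongrightarrow> 0"
        using Lim_null_comparison[where g = "\<lambda>n. L * (t + 2 * L * t\<^sup>2) * s n"]
        by (metis (no_types, lifting) always_eventually real_norm_def)
      then have "(\<lambda>n. Y (Suc n) e t) \<longlonglongrightarrow> \<Phi> t (\<lambda>e. y e t) e"
        unfolding YS LIM_zero_iff .
      moreover have "(\<lambda>n. Y (Suc n) e t) \<longlonglongrightarrow> y e t"
        using lim[OF e t] by (rule LIMSEQ_Suc)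
      ultimately show ?thesis by (rule LIMSEQ_unique)
    qed
  qed
qed

section \<open>From rigidity to infinitesimal rigidity at generic placements\<close>

text \<open>As the rows of \<open>S\<close> are independent, a dependence of the enlarged family has
  a nonzero coefficient at \<open>e\<close>. The same linear relation holds between the strains of
  \<open>w\<close>.\<close>

lemma strain_zero_if_row_dep:
  assumes "finite V" "finite S" "insert e S \<subseteq> V \<times> V"
    and "row_indep S (V \<times> UNIV) (strain_row p)" "\<not> row_indep (insert e S) (V \<times> UNIV) (strain_row p)"
    and "\<And>k. k \<in> S \<Longrightarrow> strain p w k = 0"
  shows "strain p w e = 0"
proof -
  obtain c where c: "\<And>j. j \<in> V \<times> UNIV \<Longrightarrow> (\<Sum>k\<in>insert e S. c k * strain_row p k j) = 0"
    and nz: "\<not> (\<forall>k\<in>insert e S. c k = 0)"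
    using assms(5) unfolding row_indep_def by blast
  have "e \<notin> S" using assms(4,5) by (metis insert_absorb)
  have "c e \<noteq> 0"
  proof
    assume "c e = 0"
    then have "(\<Sum>k\<in>S. c k * strain_row p k j) = 0" if "j \<in> V \<times> UNIV" for j
      using c[OF that] assms(2) \<open>e \<notin> S\<close> by simp
    then have "\<forall>k\<in>S. c k = 0" using row_indepD[OF assms(4)] by blast
    then show False using nz \<open>c e = 0\<close> by simp
  qed
  have "(\<Sum>k\<in>insert e S. c k * strain p w k)
    = (\<Sum>k\<in>insert e S. \<Sum>j\<in>V \<times> UNIV. c k * strain_row p k j * w (fst j) $ snd j)"
    using assms(1,3) by (intro sum.cong refl) (auto simp: strain_eq_sum sum_distrib_left mult.assoc)
  also have "\<dots> = (\<Sum>j\<in>V \<times> UNIV. (\<Sum>k\<in>insert e S. c k * strain_row p k j) * w (fst j) $ snd j)"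
    by (subst sum.swap) (simp only: sum_distrib_right)
  also have "\<dots> = 0" by (intro sum.neutral) (simp add: c)
  finally have "c e * strain p w e = 0"
    using assms(2,6) \<open>e \<notin> S\<close> by simp
  then show ?thesis using \<open>c e \<noteq> 0\<close> by simp
qed

lemma rational_polynomial_fun_strain_row:
  fixes j :: "'v \<times> 'd::finite"
  assumes "fst e \<in> V" "snd e \<in> V"
  shows "rational_polynomial_fun V (\<lambda>p. strain_row p e j)"
proof -
  have *: "rational_polynomial_fun V (\<lambda>p :: 'v \<Rightarrow> real ^ 'd. p u $ snd j - p v $ snd j)" if "u \<in> V" "v \<in> V" for u v
    using that by (intro rational_polynomial_fun_diff rational_polynomial_fun_coord)
  show ?thesis
    using *[OF assms] *[OF assms(2,1)] rational_polynomial_fun_zero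
    by (cases "fst j = fst e"; cases "fst j = snd e") (simp_all add: strain_row_def)
qed

text \<open>A flex in the direction of an infinitesimal motion \<open>v\<close> is sought as
  \<open>p + t v + (\<Sum>k\<in>S. y k * b k)\<close>, where \<open>S\<close> is a maximal independent set of edges at \<open>p\<close> and \<open>b\<close> is dual
  to its rows. The lengths of the edges in \<open>S\<close> are preserved iff \<open>y\<close> is a fixed point of the
  quadratic map \<open>\<Phi> t\<close> below. At the midpoint, near \<open>p\<close>, the rows of \<open>S\<close> are still independent and, by
  genericity of \<open>p\<close>, span the remaining rows, so all other edge lengths are preserved as well.\<close>

lemma generic_rigid_imp_inf_rigid:
  fixes p :: "'v \<Rightarrow> real ^ 'd::finite"
  assumes V: "finite V" and gen: "generic_placement V p" and rigid: "rigid_framework V E p"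
  shows "inf_rigid V E p"
  unfolding inf_rigid_def
proof (intro allI impI ballI)
  fix v and u1 u2
  assume v: "\<forall>u\<in>V. \<forall>u'\<in>V. {u, u'} \<in> E \<longrightarrow> strain p v (u, u') = 0" and u12: "u1 \<in> V" "u2 \<in> V"
  let ?J = "V \<times> (UNIV :: 'd set)"
  define F where "F = {(u, u'). u \<in> V \<and> u' \<in> V \<and> {u, u'} \<in> E}"
  have F: "F \<subseteq> V \<times> V" "finite F"
    using V by (auto simp: F_def intro: finite_subset[of _ "V \<times> V"])
  have strain_v: "strain p v e = 0" if "e \<in> F" for e using v that by (auto simp: F_def)
  define I where "I = {S. S \<subseteq> F \<and> row_indep S ?J (strain_row p)}"
  have "\<exists>S\<in>I. \<forall>S'\<in>I. S \<subseteq> S' \<longrightarrow> S = S'"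
  proof (rule finite_has_maximal)
    show "finite I" using F by (simp add: I_def)
    have "{} \<in> I" by (simp add: I_def row_indep_def)
    then show "I \<noteq> {}" by blast
  qed
  then obtain S where "S \<in> I" and max: "\<And>S'. S' \<in> I \<Longrightarrow> S \<subseteq> S' \<Longrightarrow> S = S'"
    by blast
  then have S: "S \<subseteq> F" "row_indep S ?J (strain_row p)" by (auto simp: I_def)
  have "finite S" "S \<subseteq> V \<times> V" using S(1) F finite_subset by auto
  obtain b0 where b0: "\<And>e e'. e \<in> S \<Longrightarrow> e' \<in> S \<Longrightarrow> (\<Sum>j\<in>?J. strain_row p e j * b0 e' j) = (if e = e' then 1 else 0)"
    by (rule row_indep_duals[OF \<open>finite S\<close> _ S(2)]) (use V in auto)
  define b :: "'v \<times> 'v \<Rightarrow> 'v \<Rightarrow> real ^ 'd" where "b e u = (\<chi> c. b0 e (u, c))" for e u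
  have b: "strain p (b e') e = (if e = e' then 1 else 0)" if "e \<in> S" "e' \<in> S" for e e'
    using that b0[OF that] \<open>S \<subseteq> V \<times> V\<close> by (subst strain_eq_sum[OF V]) (auto simp: b_def)
  define disp where "disp t y u = t *\<^sub>R v u + (\<Sum>k\<in>S. y k *\<^sub>R b k u)" for t y u
  define \<Delta> where "\<Delta> f e = f (fst e) - f (snd e)" for f :: "'v \<Rightarrow> real ^ 'd" and e
  have \<Delta>_disp: "\<Delta> (disp t y) e = t *\<^sub>R \<Delta> v e + (\<Sum>k\<in>S. y k *\<^sub>R \<Delta> (b k) e)" for t y e
    by (simp add: \<Delta>_def disp_def scaleR_diff_right sum_subtractf)
  have strain_\<Delta>: "strain f g e = \<Delta> f e \<bullet> \<Delta> g e" for f g :: "'v \<Rightarrow> real ^ 'd" and e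
    by (simp add: strain_def \<Delta>_def)
  \<comment> \<open>As \<open>v\<close> has zero strain on edges and \<open>b\<close> is dual to the
    rows, the strain at \<open>p\<close> reads off the coefficient \<open>y e\<close>.\<close>
  have strain_disp: "strain p (disp t y) e = y e" if "e \<in> S" for t y e
  proof -
    have "strain p (disp t y) e = t * strain p v e + (\<Sum>k\<in>S. y k * strain p (b k) e)"
      unfolding strain_\<Delta> \<Delta>_disp by (simp add: inner_add_right inner_sum_right)
    also have "(\<Sum>k\<in>S. y k * strain p (b k) e) = (\<Sum>k\<in>S. if e = k then y k else 0)"
      using that by (intro sum.cong) (auto simp: b)
    finally show ?thesis using that S(1) \<open>finite S\<close> strain_v[of e] by auto
  qed
  define K where "K = (\<Sum>e\<in>S. norm (\<Delta> v e) + (\<Sum>k\<in>S. norm (\<Delta> (b k) e)))"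
  have K: "norm (\<Delta> v e) + (\<Sum>k\<in>S. norm (\<Delta> (b k) e)) \<le> K" if "e \<in> S" for e
    unfolding K_def
    by (rule member_le_sum[where f = "\<lambda>e. norm (\<Delta> v e) + (\<Sum>k\<in>S. norm (\<Delta> (b k) e))"])
      (use that \<open>finite S\<close> in \<open>auto intro!: add_nonneg_nonneg sum_nonneg\<close>)
  have K_\<Delta>: "norm (\<Delta> v e) \<le> K" "(\<Sum>k\<in>S. norm (\<Delta> (b k) e)) \<le> K" if "e \<in> S" for e
  proof -
    have "0 \<le> (\<Sum>k\<in>S. norm (\<Delta> (b k) e))" by (simp add: sum_nonneg)
    then show "norm (\<Delta> v e) \<le> K" using K[OF that] by linarith
    show "(\<Sum>k\<in>S. norm (\<Delta> (b k) e)) \<le> K" using K[OF that] norm_ge_zero[of "\<Delta> v e"] by linarith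
  qed
  have "K \<ge> 0" unfolding K_def by (intro sum_nonneg add_nonneg_nonneg) auto
  \<comment> \<open>With displacement \<open>w = disp t y\<close>, the length of \<open>e\<close> is
    preserved iff \<open>strain p w e + strain w w e / 2 = 0\<close>. For \<open>e\<close> in
    \<open>S\<close> this reads \<open>y e = \<Phi> t y e\<close>.\<close>
  define \<Phi> where "\<Phi> t y e = - strain (disp t y) (disp t y) e / 2" for t y e
  obtain \<tau> y where \<tau>: "\<tau> > 0" and y_cont: "\<And>e. e \<in> S \<Longrightarrow> continuous_on {0..\<tau>} (y e)"
    and y_bound: "\<And>t e. t \<in> {0..\<tau>} \<Longrightarrow> e \<in> S \<Longrightarrow> \<bar>y e t\<bar> \<le> 2 * (K\<^sup>2 + 1) * t\<^sup>2"
    and y_fix: "\<And>t e. t \<in> {0..\<tau>} \<Longrightarrow> e \<in> S \<Longrightarrow> \<Phi> t (\<lambda>e. y e t) e = y e t"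
  \<comment> \<open>The estimates give the constant \<open>K\<^sup>2\<close>; adding 1 makes it
    positive even if \<open>K = 0\<close>.\<close>
  proof (rule small_fixed_point[OF \<open>finite S\<close>, of "K\<^sup>2 + 1" \<Phi>])
    show "0 < K\<^sup>2 + 1" by (simp add: add_nonneg_pos)
    show "\<bar>\<Phi> t (\<lambda>_. 0) e\<bar> \<le> (K\<^sup>2 + 1) * t\<^sup>2" if "0 \<le> t" "e \<in> S" for t e
    proof -
      have "\<bar>\<Phi> t (\<lambda>_. 0) e\<bar> = t\<^sup>2 * (norm (\<Delta> v e))\<^sup>2 / 2"
        using that by (simp add: \<Phi>_def strain_\<Delta> \<Delta>_disp dot_square_norm power_mult_distrib)
      also have "\<dots> \<le> t\<^sup>2 * (norm (\<Delta> v e))\<^sup>2" by simp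
      also have "\<dots> \<le> t\<^sup>2 * (K\<^sup>2 + 1)"
        using power_mono[OF K_\<Delta>(1)[OF that(2)], of 2] by (intro mult_left_mono) auto
      finally show ?thesis by (simp add: mult.commute)
    qed
    show "\<bar>\<Phi> t y e - \<Phi> t y' e\<bar> \<le> (K\<^sup>2 + 1) * (t + r) * s"
      if t: "0 \<le> t" and e: "e \<in> S" and r: "\<And>e. e \<in> S \<Longrightarrow> \<bar>y e\<bar> \<le> r" "\<And>e. e \<in> S \<Longrightarrow> \<bar>y' e\<bar> \<le> r"
        and s: "\<And>e. e \<in> S \<Longrightarrow> \<bar>y e - y' e\<bar> \<le> s" for t r s y y' e
    proof -
      have "r \<ge> 0" "s \<ge> 0" using r(1)[OF e] s[OF e] by linarith+
      let ?A = "\<Delta> (disp t y) e" and ?B = "\<Delta> (disp t y') e"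
      have sum_le: "norm (\<Sum>k\<in>S. z k *\<^sub>R \<Delta> (b k) e) \<le> q * K" if "\<And>k. k \<in> S \<Longrightarrow> \<bar>z k\<bar> \<le> q" "q \<ge> 0" for z q
      proof -
        have "norm (\<Sum>k\<in>S. z k *\<^sub>R \<Delta> (b k) e) \<le> (\<Sum>k\<in>S. q * norm (\<Delta> (b k) e))"
          using that by (intro sum_norm_le) (auto intro: mult_right_mono)
        also have "\<dots> \<le> q * K" unfolding sum_distrib_left[symmetric]
          using K_\<Delta>(2)[OF e] that(2) by (rule mult_left_mono)
        finally show ?thesis .
      qed
      have le: "norm (\<Delta> (disp t z) e) \<le> K * (t + r)" if "\<And>k. k \<in> S \<Longrightarrow> \<bar>z k\<bar> \<le> r" for z
      proof -
        have "norm (\<Delta> (disp t z) e) \<le> t * norm (\<Delta> v e) + norm (\<Sum>k\<in>S. z k *\<^sub>R \<Delta> (b k) e)"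
          unfolding \<Delta>_disp using norm_triangle_ineq[of "t *\<^sub>R \<Delta> v e"] t by simp
        also have "\<dots> \<le> t * K + r * K"
          using sum_le[OF that \<open>r \<ge> 0\<close>] K_\<Delta>(1)[OF e] t by (intro add_mono mult_left_mono) auto
        finally show ?thesis by (simp add: algebra_simps)
      qed
      have "?A - ?B = (\<Sum>k\<in>S. (y k - y' k) *\<^sub>R \<Delta> (b k) e)"
        by (simp add: \<Delta>_disp scaleR_diff_left sum_subtractf)
      then have diff: "norm (?A - ?B) \<le> s * K" using sum_le[OF s \<open>s \<ge> 0\<close>] by simp
      have "norm (?A + ?B) \<le> 2 * (K * (t + r))"
        using norm_triangle_ineq[of ?A ?B] le[of y] le[of y'] r by fastforce
      then have "norm (?A + ?B) * norm (?A - ?B) \<le> 2 * (K * (t + r)) * (s * K)"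
        using diff \<open>K \<ge> 0\<close> t \<open>r \<ge> 0\<close> by (intro mult_mono) auto
      \<comment> \<open>The difference of squared norms factors into a sum, which is small, and a
        difference, which is Lipschitz in \<open>y\<close>.\<close>
      moreover have "\<Phi> t y e - \<Phi> t y' e = - ((?A + ?B) \<bullet> (?A - ?B)) / 2"
        by (simp add: \<Phi>_def strain_\<Delta> inner_add_left inner_add_right inner_diff_left inner_diff_right
            inner_commute field_simps)
      ultimately have "\<bar>\<Phi> t y e - \<Phi> t y' e\<bar> \<le> K\<^sup>2 * (t + r) * s"
        using Cauchy_Schwarz_ineq2[of "?A + ?B" "?A - ?B"] by (simp add: power2_eq_square mult_ac)
      also have "\<dots> \<le> (K\<^sup>2 + 1) * (t + r) * s"
        using t \<open>r \<ge> 0\<close> \<open>s \<ge> 0\<close> by (intro mult_right_mono) auto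
      finally show ?thesis .
    qed
    show "continuous_on A (\<lambda>t. \<Phi> t (\<lambda>e. y e t) e)"
      if "\<And>e. e \<in> S \<Longrightarrow> continuous_on A (y e)" for A y e
      unfolding \<Phi>_def strain_\<Delta> \<Delta>_disp using that by (intro continuous_intros) auto
  qed blast
  define w where "w t = disp t (\<lambda>e. y e t)" for t
  define q where "q u t = p u + w t u" for u t
  have y0: "y e 0 = 0" if "e \<in> S" for e using y_bound[of 0 e] \<tau> that by simp
  then have w0: "w 0 u = 0" for u by (simp add: w_def disp_def)
  have q_cont: "continuous_on {0..\<tau>} (q u)" for u
    unfolding q_def w_def disp_def using y_cont by (intro continuous_intros) auto
  define mid where "mid t u = midpoint (p u) (q u t)" for t u
  have strain_mid: "strain (mid t) f e = strain p f e + strain (w t) f e / 2" for t f e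
  proof -
    have "\<Delta> (mid t) e = \<Delta> p e + (1/2) *\<^sub>R \<Delta> (w t) e"
      by (simp add: mid_def q_def midpoint_def \<Delta>_def algebra_simps flip: scaleR_2)
    then show ?thesis by (simp add: strain_\<Delta> inner_add_left)
  qed
  have dist_q: "dist (q u t) (q u' t) = dist (p u) (p u') \<longleftrightarrow> strain (mid t) (w t) (u, u') = 0" for u u' t
  proof -
    have "mid t = (\<lambda>u. midpoint (p u) (q u t))" "w t = (\<lambda>u. q u t - p u)"
      by (simp_all add: mid_def q_def fun_eq_iff)
    then show ?thesis using dist_eq_iff_strain_midpoint[of "\<lambda>u. q u t" u u' p] by (simp only:)
  qed
  have q_lim: "((\<lambda>t. q u t) \<longlongrightarrow> p u) (at_right 0)" for u
  proof -
    have "continuous (at_right 0) (q u)"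
      using q_cont[of u] \<tau> continuous_on_Icc_at_rightD continuous_within by metis
    moreover have "q u 0 = p u" by (simp add: q_def w0)
    ultimately show ?thesis by (simp add: continuous_within)
  qed
  have mid_lim: "((\<lambda>t. mid t u) \<longlongrightarrow> p u) (at_right 0)" for u
  proof -
    have "((\<lambda>t. mid t u) \<longlongrightarrow> midpoint (p u) (p u)) (at_right 0)"
      unfolding mid_def midpoint_def by (intro tendsto_intros q_lim)
    then show ?thesis by simp
  qed
  have "\<forall>\<^sub>F x in filtermap mid (at_right 0). row_indep S ?J (strain_row x)"
  proof (rule row_indep_tendsto[of S ?J strain_row p, OF \<open>finite S\<close> _ S(2)])
    show "((\<lambda>x. strain_row x e j) \<longlongrightarrow> strain_row p e j) (filtermap mid (at_right 0))" for e j
      unfolding strain_row_def filterlim_filtermap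
      by (intro tendsto_intros mid_lim)
  qed
  then have "\<forall>\<^sub>F t in at_right 0. row_indep S ?J (strain_row (mid t))"
    by (simp add: eventually_filtermap)
  then obtain \<tau>' where \<tau>': "\<tau>' > 0" "\<And>t. 0 < t \<Longrightarrow> t < \<tau>' \<Longrightarrow> row_indep S ?J (strain_row (mid t))"
    unfolding eventually_at_right_field by blast
  have strain_F: "strain (mid t) (w t) e = 0" if t: "t \<in> {0..\<tau>}" "t < \<tau>'" and e: "e \<in> F" for t e
  proof (cases "t = 0")
    case True
    then show ?thesis by (simp add: strain_def w0)
  next
    case False
    have strain_S: "strain (mid t) (w t) k = 0" if "k \<in> S" for k
      using y_fix[OF t(1) that] strain_disp[OF that] by (simp add: strain_mid w_def \<Phi>_def)
    have ind: "row_indep S ?J (strain_row (mid t))" using False t by (intro \<tau>') auto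
    show ?thesis
    proof (cases "e \<in> S")
      case False
      \<comment> \<open>Adding \<open>e\<close> to the maximal \<open>S\<close> gives dependent rows
        at \<open>p\<close>. By genericity, independence at the midpoint would force independence at
        \<open>p\<close>, so row \<open>e\<close> depends on \<open>S\<close> at the midpoint as
        well.\<close>
      then have "\<not> row_indep (insert e S) ?J (strain_row p)"
        using max[of "insert e S"] e S(1) by (auto simp: I_def)
      moreover have "row_indep (insert e S) ?J (strain_row p)" if "row_indep (insert e S) ?J (strain_row (mid t))"
      proof (rule row_indep_generic[where M = strain_row, OF gen _ _ that])
        show "rational_polynomial_fun V (\<lambda>x. strain_row x k j)" if "k \<in> insert e S" for k j
          using that e S(1) F(1) by (intro rational_polynomial_fun_strain_row) auto
      qed (use \<open>finite S\<close> in simp)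
      ultimately show ?thesis
        using strain_zero_if_row_dep[OF V \<open>finite S\<close> _ ind _ strain_S] e S(1) F(1) by blast
    qed (use strain_S in simp)
  qed
  \<comment> \<open>Time is rescaled by \<open>\<rho>\<close> to the unit interval; halving
    \<open>\<tau>'\<close> keeps it strictly below that bound.\<close>
  define \<rho> where "\<rho> = min \<tau> (\<tau>' / 2)"
  have \<rho>: "\<rho> > 0" "\<rho> \<le> \<tau>" "\<rho> < \<tau>'" using \<tau> \<tau>' by (auto simp: \<rho>_def min_def)
  have scale: "\<rho> * t \<in> {0..\<rho>}" if "t \<in> {0..1}" for t
    using that \<rho> by (auto intro: mult_left_le)
  have flex: "(\<forall>u\<in>V. continuous_on {0..1} (\<lambda>t. q u (\<rho> * t)) \<and> q u (\<rho> * 0) = p u) \<and>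
    (\<forall>t\<in>{0..1}. \<forall>u\<in>V. \<forall>u'\<in>V. {u, u'} \<in> E \<longrightarrow> dist (q u (\<rho> * t)) (q u' (\<rho> * t)) = dist (p u) (p u'))"
  proof (intro conjI ballI impI)
    fix u
    show "continuous_on {0..1} (\<lambda>t. q u (\<rho> * t))"
    proof (rule continuous_on_compose2[OF q_cont])
      show "continuous_on {0..1} ((*) \<rho>)" by (intro continuous_intros)
      show "(*) \<rho> ` {0..1} \<subseteq> {0..\<tau>}" using scale \<rho>(2) by force
    qed
    show "q u (\<rho> * 0) = p u" by (simp add: q_def w0)
  next
    fix t u u' assume t: "t \<in> {0..1::real}" and e: "u \<in> V" "u' \<in> V" "{u, u'} \<in> E"
    have "\<rho> * t \<in> {0..\<tau>}" "\<rho> * t < \<tau>'"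
      using scale[OF t] \<rho> unfolding atLeastAtMost_iff by linarith+
    then show "dist (q u (\<rho> * t)) (q u' (\<rho> * t)) = dist (p u) (p u')"
      unfolding dist_q using e by (intro strain_F) (auto simp: F_def)
  qed
  have congruent: "\<forall>t\<in>{0..1}. \<forall>u\<in>V. \<forall>u'\<in>V. dist (q u (\<rho> * t)) (q u' (\<rho> * t)) = dist (p u) (p u')"
    using rigid[unfolded rigid_framework_def, THEN spec, of "\<lambda>u t. q u (\<rho> * t)"] flex by blast
  let ?e = "(u1, u2)"
  \<comment> \<open>\<open>r t\<close> is the mean velocity up to time \<open>t\<close>. It tends to
    \<open>v\<close> because \<open>y\<close> is quadratically small.\<close>
  define r where "r t u = v u + (\<Sum>k\<in>S. (y k t / t) *\<^sub>R b k u)" for t u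
  have w_r: "w t u = t *\<^sub>R r t u" if "t \<noteq> 0" for t u
    using that by (simp add: w_def r_def disp_def scaleR_add_right scaleR_sum_right)
  have y_small: "((\<lambda>t. y k t / t) \<longlongrightarrow> 0) (at_right 0)" if "k \<in> S" for k
  proof (rule Lim_null_comparison)
    have "\<forall>\<^sub>F t in at_right 0. t \<in> {0<..<\<tau>}"
      using \<tau> by (rule eventually_at_right_real)
    then show "\<forall>\<^sub>F t in at_right 0. norm (y k t / t) \<le> 2 * (K\<^sup>2 + 1) * t"
    proof eventually_elim
      case (elim t)
      then have "\<bar>y k t\<bar> \<le> (2 * (K\<^sup>2 + 1) * t) * t"
        using y_bound[of t k] that by (simp add: power2_eq_square mult.assoc)
      then show ?case using elim by (simp add: divide_le_eq)
    qed
    show "((\<lambda>t. 2 * (K\<^sup>2 + 1) * t) \<longlongrightarrow> 0) (at_right 0)"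
      by (auto intro!: tendsto_eq_intros)
  qed
  have r_lim: "((\<lambda>t. r t u) \<longlongrightarrow> v u) (at_right 0)" for u
  proof -
    have "((\<lambda>t. r t u) \<longlongrightarrow> v u + (\<Sum>k\<in>S. 0 *\<^sub>R b k u)) (at_right 0)"
      unfolding r_def by (intro tendsto_intros y_small)
    then show ?thesis by simp
  qed
  \<comment> \<open>Congruence on the pair \<open>?e\<close>, divided by \<open>t\<close>, passes to
    the limit \<open>strain p v ?e = 0\<close>.\<close>
  have "((\<lambda>t. strain p (r t) ?e + t * strain (r t) (r t) ?e / 2) \<longlongrightarrow> strain p v ?e + 0 * strain v v ?e / 2) (at_right 0)"
    unfolding strain_def by (intro tendsto_intros r_lim) simp
  moreover have "\<forall>\<^sub>F t in at_right 0. strain p (r t) ?e + t * strain (r t) (r t) ?e / 2 = 0"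
  proof -
    have "\<forall>\<^sub>F t in at_right 0. t \<in> {0<..<\<rho>}"
      using \<rho>(1) by (rule eventually_at_right_real)
    then show ?thesis
    proof eventually_elim
      case (elim t)
      then have "t / \<rho> \<in> {0..1}" "\<rho> * (t / \<rho>) = t" using \<rho>(1) by auto
      then have "strain (mid t) (w t) ?e = 0"
        using congruent u12 unfolding dist_q by metis
      then have "\<Delta> p ?e \<bullet> \<Delta> (w t) ?e + \<Delta> (w t) ?e \<bullet> \<Delta> (w t) ?e / 2 = 0"
        unfolding strain_mid unfolding strain_\<Delta> .
      moreover have "\<Delta> (w t) ?e = t *\<^sub>R \<Delta> (r t) ?e"
        using elim by (simp add: \<Delta>_def w_r scaleR_diff_right)
      ultimately have "t * (strain p (r t) ?e + t * strain (r t) (r t) ?e / 2) = 0"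
        by (simp add: strain_\<Delta> algebra_simps)
      then show ?case using elim by auto
    qed
  qed
  ultimately have "((\<lambda>t. 0) \<longlongrightarrow> strain p v ?e) (at_right (0::real))"
    using tendsto_cong by fastforce
  then show "strain p v (u1, u2) = 0"
    by (simp add: tendsto_const_iff)
qed

section \<open>The coincident placement\<close>

lemma strain_swap: "strain p w (u, v) = strain p w (v, u)"
  by (simp add: strain_def inner_diff_left inner_diff_right)

text \<open>All of \<open>A\<close> lies at \<open>a\<close> and all of \<open>B\<close> at
  \<open>b\<close>, so zero strain on an edge equates the components of its two velocities along
  \<open>b - a\<close>. These components are then constant along walks.\<close>

lemma strain_same_component:
  assumes "same_component V (bip_edges E A B) u v"
    and p: "\<And>x. x \<in> A \<Longrightarrow> p x = a" "\<And>x. x \<in> B \<Longrightarrow> p x = b"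
    and w: "\<And>x y. x \<in> A \<Longrightarrow> y \<in> B \<Longrightarrow> {x, y} \<in> E \<Longrightarrow> strain p w (x, y) = 0"
  shows "(w u - w v) \<bullet> (b - a) = 0"
proof -
  have step: "w x \<bullet> (b - a) = w y \<bullet> (b - a)" if "{x, y} \<in> bip_edges E A B" for x y
  proof -
    from that obtain x' y' where *: "x' \<in> A" "y' \<in> B" "{x', y'} \<in> E" "{x, y} = {x', y'}"
      unfolding bip_edges_def by blast
    then have "(a - b) \<bullet> (w x' - w y') = 0"
      using w[OF *(1-3)] by (simp add: strain_def p)
    then have "w x' \<bullet> (b - a) = w y' \<bullet> (b - a)"
      by (simp add: inner_diff_left inner_diff_right inner_commute)
    then show ?thesis using *(4) by (auto simp: doubleton_eq_iff)
  qed
  have "(u, v) \<in> {(x, y). {x, y} \<in> bip_edges E A B}\<^sup>*"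
    using assms(1) by (simp add: same_component_def)
  then have "w u \<bullet> (b - a) = w v \<bullet> (b - a)"
    by induction (use step in auto)
  then show ?thesis by (simp add: inner_diff_left)
qed

lemma inf_rigid_coincident:
  fixes V :: "'v set" and p :: "nat \<Rightarrow> real ^ 'd::finite"
  assumes V: "(\<Union>i\<in>{1..m}. P i) = V"
    and c: "\<And>i v. i \<in> {1..m} \<Longrightarrow> v \<in> P i \<Longrightarrow> c v = i"
    and ne: "\<And>i. i \<in> {1..m} \<Longrightarrow> P i \<noteq> {}"
    and gen: "generic_placement {1..m} p"
    and rigid: "inf_rigid {1..m} (reduced_edges E P m) p"
    and comp: "\<And>i u v. i \<in> {1..m} \<Longrightarrow> u \<in> P i \<Longrightarrow> v \<in> P i \<Longrightarrow> u \<noteq> v \<Longrightarrow>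
           card {j \<in> {1..m} - {i}. same_component (P i \<union> P j) (bip_edges E (P i) (P j)) u v}
             \<ge> CARD('d)"
  shows "inf_rigid V E (p \<circ> c)"
  unfolding inf_rigid_def
proof (intro allI impI ballI)
  fix w :: "'v \<Rightarrow> real ^ 'd" and v v'
  assume w: "\<forall>u\<in>V. \<forall>u'\<in>V. {u, u'} \<in> E \<longrightarrow> strain (p \<circ> c) w (u, u') = 0"
    and v: "v \<in> V" "v' \<in> V"
  have PV: "x \<in> V" if "i \<in> {1..m}" "x \<in> P i" for i x using V that by blast
  have const: "w x = w y" if i: "i \<in> {1..m}" and xy: "x \<in> P i" "y \<in> P i" for i x y
  proof (cases "x = y")
    case False
    define J where "J = {j \<in> {1..m} - {i}. same_component (P i \<union> P j) (bip_edges E (P i) (P j)) x y}"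
    have "CARD('d) \<le> card J" using comp[OF i xy False] by (simp add: J_def)
    moreover have "finite J" by (simp add: J_def)
    \<comment> \<open>\<open>\<sigma>\<close> picks a different index of \<open>J\<close> for each
      coordinate; genericity makes the directions from \<open>p i\<close> to these points
      span.\<close>
    ultimately obtain \<sigma> :: "'d \<Rightarrow> nat" where \<sigma>: "range \<sigma> \<subseteq> J" "inj \<sigma>"
      using card_le_inj[of "UNIV :: 'd set" J] by auto
    have "spanning_at i \<sigma> p"
      by (rule generic_spanning_at[OF gen \<sigma>(2)]) (use \<sigma>(1) i in \<open>auto simp: J_def\<close>)
    moreover have "(w x - w y) \<bullet> (p (\<sigma> k) - p i) = 0" for k
    proof -
      have "\<sigma> k \<in> J" using \<sigma>(1) by blast
      then have k: "\<sigma> k \<in> {1..m}" and sc: "same_component (P i \<union> P (\<sigma> k)) (bip_edges E (P i) (P (\<sigma> k))) x y"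
        by (simp_all add: J_def)
      show ?thesis
        by (rule strain_same_component[OF sc, of "p \<circ> c"]) (use w PV i k c in auto)
    qed
    ultimately have "w x - w y = 0" unfolding spanning_at_def by blast
    then show ?thesis by simp
  qed simp
  \<comment> \<open>Velocities are constant on each part, so any representative gives the induced
    motion of the reduced graph.\<close>
  define g where "g i = w (SOME x. x \<in> P i)" for i
  have w_g: "w x = g i" if "i \<in> {1..m}" "x \<in> P i" for i x
    unfolding g_def using that by (intro const[of i]) (auto intro: someI)
  have strain_g: "strain (p \<circ> c) w (x, y) = strain p g (i, j)"
    if "i \<in> {1..m}" "j \<in> {1..m}" "x \<in> P i" "y \<in> P j" for i j x y
    using that by (simp add: strain_def c[OF that(1,3)] c[OF that(2,4)] w_g[OF that(1,3)] w_g[OF that(2,4)])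
  have "strain p g (i, j) = 0" if ij: "{i, j} \<in> reduced_edges E P m" for i j
  proof -
    from ij obtain i' j' x y where *: "i' \<in> {1..m}" "j' \<in> {1..m}" "x \<in> P i'" "y \<in> P j'"
        "{x, y} \<in> E" "{i, j} = {i', j'}"
      unfolding reduced_edges_def by blast
    then have "strain p g (i', j') = 0"
      using w PV strain_g[OF *(1-4)] by auto
    with *(6) show ?thesis by (auto simp: doubleton_eq_iff strain_swap)
  qed
  then have all: "strain p g (i, j) = 0" if "i \<in> {1..m}" "j \<in> {1..m}" for i j
    using inf_rigidD[OF rigid] that by blast
  obtain i j where "i \<in> {1..m}" "v \<in> P i" "j \<in> {1..m}" "v' \<in> P j" using v V by blast
  then show "strain (p \<circ> c) w (v, v') = 0" using strain_g all by metis
qed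

section \<open>Perturbation of the coincident placement to a generic one\<close>

theorem theorem7p1:
  fixes V :: "'v set" and E :: "'v set set" and P :: "nat \<Rightarrow> 'v set" and m :: nat
  assumes "m \<ge> CARD('d::finite) + 1"
    and "simple_graph V E"
    and "(\<Union>i\<in>{1..m}. P i) = V"
    and "disjoint_family_on P {1..m}"
    and "\<And>i. i \<in> {1..m} \<Longrightarrow> P i \<noteq> {}"
    and "d_rigid TYPE('d) {1..m} (reduced_edges E P m)"
    and "\<And>i u v. i \<in> {1..m} \<Longrightarrow> u \<in> P i \<Longrightarrow> v \<in> P i \<Longrightarrow> u \<noteq> v \<Longrightarrow>
           card {j \<in> {1..m} - {i}. same_component (P i \<union> P j) (bip_edges E (P i) (P j)) u v}
             \<ge> CARD('d)"
  shows "d_rigid TYPE('d) V E"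
proof -
  have "finite V" using assms(2) by (simp add: simple_graph_def)
  obtain p :: "nat \<Rightarrow> real ^ 'd" where gen: "generic_placement {1..m} p"
    and rigid: "rigid_framework {1..m} (reduced_edges E P m) p"
    using assms(6) unfolding d_rigid_def by blast
  define c where "c v = (THE i. i \<in> {1..m} \<and> v \<in> P i)" for v
  have c: "c v = i" if "i \<in> {1..m}" "v \<in> P i" for i v
    unfolding c_def
  proof (rule the_equality)
    show "j = i" if "j \<in> {1..m} \<and> v \<in> P j" for j
      using assms(4) that \<open>i \<in> {1..m}\<close> \<open>v \<in> P i\<close> unfolding disjoint_family_on_def by blast
  qed (use that in blast)
  have inf: "inf_rigid V E (p \<circ> c)"
    using assms(3) c assms(5) gen generic_rigid_imp_inf_rigid[OF _ gen rigid] assms(7)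
    by (rule inf_rigid_coincident) auto
  \<comment> \<open>The bound on \<open>m\<close> leaves at least \<open>CARD('d)\<close> indices
    besides 1, enough for a spanning family based at \<open>p 1\<close>.\<close>
  have "CARD('d) \<le> card ({1..m} - {1})" using assms(1) by simp
  then obtain \<sigma> :: "'d \<Rightarrow> nat" where \<sigma>: "range \<sigma> \<subseteq> {1..m} - {1}" "inj \<sigma>"
    using card_le_inj[of "UNIV :: 'd set" "{1..m} - {1}"] by auto
  have 1: "1 \<in> {1..m}" using assms(1) by simp
  have sp: "spanning_at 1 \<sigma> p"
    by (rule generic_spanning_at[OF gen \<sigma>(2)]) (use \<sigma>(1) 1 in auto)
  \<comment> \<open>Representatives of the parts carry the spanning family of indices over to
    vertices in \<open>V\<close>.\<close>
  define r where "r i = (SOME v. v \<in> P i)" for i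
  have r: "r i \<in> P i" if "i \<in> {1..m}" for i
    unfolding r_def using assms(5)[OF that] by (simp add: some_in_eq)
  have cr: "c (r i) = i" if "i \<in> {1..m}" for i using c r that by blast
  have \<sigma>_in: "\<sigma> k \<in> {1..m}" for k using \<sigma>(1) by blast
  have sp': "spanning_at (r 1) (r \<circ> \<sigma>) (p \<circ> c)"
    using sp unfolding spanning_at_def o_apply cr[OF 1] cr[OF \<sigma>_in] .
  have rV: "r 1 \<in> V" "range (r \<circ> \<sigma>) \<subseteq> V"
    using r[OF 1] 1 r[OF \<sigma>_in] \<sigma>_in unfolding assms(3)[symmetric] o_def by blast+
  obtain \<epsilon> where \<epsilon>: "\<epsilon> > 0" and near: "\<And>q. (\<And>u. u \<in> V \<Longrightarrow> dist (q u) ((p \<circ> c) u) < \<epsilon>) \<Longrightarrow>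
      spanning_at (r 1) (r \<circ> \<sigma>) q \<and> inf_rigid V E q"
    using inf_rigid_near[OF \<open>finite V\<close> rV sp' inf] by blast
  \<comment> \<open>Half the radius is kept in reserve: the ball of radius
    \<open>\<epsilon> / 2\<close> around \<open>q\<close> still lies within
    \<open>\<epsilon>\<close> of \<open>p \<circ> c\<close>.\<close>
  obtain q :: "'v \<Rightarrow> real ^ 'd" where q: "generic_placement V q"
      "\<And>v. v \<in> V \<Longrightarrow> dist (q v) ((p \<circ> c) v) < \<epsilon> / 2"
    using generic_placement_dense[OF \<open>finite V\<close>, of "\<epsilon> / 2" "p \<circ> c"] \<epsilon> by auto
  have "rigid_framework V E q"
  proof (rule rigid_framework_if_inf_rigid_near[OF \<open>finite V\<close> _ rV])
    show "spanning_at (r 1) (r \<circ> \<sigma>) q" using near q(2) \<epsilon> by force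
    show "inf_rigid V E x" if "\<And>u. u \<in> V \<Longrightarrow> dist (x u) (q u) < \<epsilon> / 2" for x
    proof -
      have "dist (x u) ((p \<circ> c) u) < \<epsilon>" if "u \<in> V" for u
        by (rule dist_triangle_half_r[of "q u"]) (use q(2) \<open>\<And>u. u \<in> V \<Longrightarrow> dist (x u) (q u) < \<epsilon> / 2\<close> that in \<open>auto simp: dist_commute\<close>)
      then show ?thesis using near by blast
    qed
  qed (use \<epsilon> in simp)
  with q(1) show ?thesis unfolding d_rigid_def by blast
qed

end
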